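(* Let $E=K(n,m,\mathcal D)$ and $F=K(n,m,\mathcal D')$ be two Bedford-McMullen carpets of non-doubling type, with fiber sequences $(a_j)_{j=0}^{m-1}$ and $(a_j')_{j=0}^{m-1}$ respectively. Suppose that $E$ and $F$ are Lipschitz equivalent. Then (i) the fiber sequence of $E$ is a permutation of that of $F$; (ii) if (as one may assume without loss of generality) $a_0>a_{m-1}$ and $a_0'>a_{m-1}'$, then $a_0=a_0'$ and $a_{m-1}=a_{m-1}'$.
   Context: Let $n>m\ge 2$ be integers and let $\mathcal D\subset\{0,\dots,n-1\}\times\{0,\dots,m-1\}$ be nonempty. For $\mathbf d\in\mathcal D$ let $S_{\mathbf d}(z)=\mathrm{diag}(n^{-1},m^{-1})(z+\mathbf d)$ on $\mathbb R^2$. The Bedford-McMullen carpet $E=K(n,m,\mathcal D)$ is the unique nonempty compact set with $E=\bigcup_{\mathbf d\in\mathcal D}S_{\mathbf d}(E)$, a metric space with the Euclidean distance. Its uniform Bernoulli measure $\mu_E$ is the unique Borel probability measure supported on $E$ with $\mu_E=\frac1{\#\mathcal D}\sum_{\mathbf d\in\mathcal D}\mu_E\circ S_{\mathbf d}^{-1}$. The fiber sequence of $\mathcal D$ (or of $E$) is $a_j=\#\{i:(i,j)\in\mathcal D\}$, $0\le j\le m-1$. $B_r(x)$ denotes the open ball. A Borel probability measure $\mu$ is doubling if $\sup_{x\in\mathrm{supp}\,\mu,\ r>0}\mu(B_{2r}(x))/\mu(B_r(x))<\infty$. $E$ is of non-doubling type if $\mu_E$ is not doubling. (Known, due to Li-Wei-Wen: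 this holds if and only if $a_0a_{m-1}>0$, $a_0\ne a_{m-1}$, and $a_ja_{j+1}>0$ for some $0\le j\le m-2$.) Metric spaces $X,Y$ are Lipschitz equivalent if there are a bijection $f:X\to Y$ and $C>0$ with $C^{-1}d_X(x,y)\le d_Y(f(x),f(y))\le C\,d_X(x,y)$ for all $x,y\in X$. *)

theory Defs
  imports "HOL-Probability.Probability" "HOL-Combinatorics.Permutations"
begin

text \<open>The plane is \<^typ>\<open>real \<times> real\<close>, whose library metric is the Euclidean one.\<close>

definition carpet_map :: "nat \<Rightarrow> nat \<Rightarrow> nat \<times> nat \<Rightarrow> real \<times> real \<Rightarrow> real \<times> real" where
  "carpet_map n m d z = ((fst z + real (fst d)) / real n, (snd z + real (snd d)) / real m)"

definition carpet :: "nat \<Rightarrow> nat \<Rightarrow> (nat \<times> nat) set \<Rightarrow> (real \<times> real) set" where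
  "carpet n m D = (THE E. compact E \<and> E \<noteq> {} \<and> E = (\<Union>d\<in>D. carpet_map n m d ` E))"

definition uniform_bernoulli :: "nat \<Rightarrow> nat \<Rightarrow> (nat \<times> nat) set \<Rightarrow> (real \<times> real) measure" where
  "uniform_bernoulli n m D = (THE M. prob_space M \<and> sets M = sets borel \<and>
     measure M (carpet n m D) = 1 \<and>
     (\<forall>A\<in>sets borel.
        measure M A = (\<Sum>d\<in>D. measure (distr M borel (carpet_map n m d)) A) / real (card D)))"

definition fiber :: "(nat \<times> nat) set \<Rightarrow> nat \<Rightarrow> nat" where
  "fiber D j = card {i. (i, j) \<in> D}"

definition measure_support :: "'a::metric_space measure \<Rightarrow> 'a set" where
  "measure_support M = {x. \<forall>r>0. measure M (ball x r) > 0}"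

text \<open>For \<^term>\<open>x\<close> in the support the denominator below is positive, so the total division of HOL
  does not interfere; finiteness of the supremum is boundedness above.\<close>

definition doubling_measure :: "'a::metric_space measure \<Rightarrow> bool" where
  "doubling_measure M \<longleftrightarrow>
     bdd_above {measure M (ball x (2 * r)) / measure M (ball x r) | x r. x \<in> measure_support M \<and> r > 0}"

definition non_doubling_type :: "nat \<Rightarrow> nat \<Rightarrow> (nat \<times> nat) set \<Rightarrow> bool" where
  "non_doubling_type n m D \<longleftrightarrow> \<not> doubling_measure (uniform_bernoulli n m D)"

definition lipschitz_equivalent :: "'a::metric_space set \<Rightarrow> 'b::metric_space set \<Rightarrow> bool" where
  "lipschitz_equivalent X Y \<longleftrightarrow>
     (\<exists>f C. bij_betw f X Y \<and> C > 0 \<and>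
        (\<forall>x\<in>X. \<forall>y\<in>X. inverse C * dist x y \<le> dist (f x) (f y) \<and> dist (f x) (f y) \<le> C * dist x y))"

end

(*
For an approximate square Q of E of side m^(-k), the number of subsquares at a much finer scale is,
up to a factor independent of Q, the product of the fiber sizes over the rows that Q fixes beyond
its common prefix; this is mu_E(Q) up to normalisation. A bi-Lipschitz map distorts such counts by
bounded factors only, so it transfers this mass from E to F although mu_E is not doubling.

With l the largest exponent such that n^l <= m^k, two adjacent squares of level k can have masses
in ratio about (hi/lo)^(k-l), where hi and lo are the larger and the smaller of a_0 and a_(m-1):
this requires a carry, a run of digits 0 next to a run of digits m-1. The extremal ratio is thus a
bi-Lipschitz invariant, and it fixes hi/lo. There are about (#D)^l extremal squares, which fixes
#D, and their mass is about hi^(k-l) / (#D)^k, which fixes hi. Once #D is known, the sums of the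
q-th powers of the masses fix the power sums of the fiber sequence, hence the sequence up to order.
*)

theory Submission
  imports Defs
begin

section \<open>Words, digits and levels\<close>

text \<open>The transfer of mass has a defect that shapes the rest. The map spreads one cell over
  boundedly many cells of F, and only the heaviest of these gets a lower bound; as neighbours may
  have very different masses, no bound follows for the cell that was hit. A heavy cell thus survives
  the transfer, but a light one need not: to bound the mass of an image cell from above, it is
  transferred back, and the cell reached may be any neighbour of the original. So the light cell of
  an extremal pair is built with light neighbours within a fixed number of steps.

  The count of extremal cells rests on a rigidity. If an image cell exceeds a neighbour by
  (hi/lo)^(k-l) up to a constant, it contains a run of one end digit of some length e with
  (hi/lo)^(k-l) <= C (hi/lo)^e. Hence k-l-e is bounded, and for each choice of the first l letters
  only boundedly many row patterns remain.

  The metric enters only through a relation between words of equal length; the comparison of the two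
  carpets is then pure counting.\<close>

definition words :: "'a set \<Rightarrow> nat \<Rightarrow> 'a list set" where
  "words A k = {w. set w \<subseteq> A \<and> length w = k}"

lemma finite_words: "finite A \<Longrightarrow> finite (words A k)"
  unfolding words_def by (rule finite_lists_length_eq)

lemma card_words: "finite A \<Longrightarrow> card (words A k) = card A ^ k"
  unfolding words_def by (rule card_lists_length_eq)

lemma words_append: "u \<in> words A k \<Longrightarrow> v \<in> words A l \<Longrightarrow> u @ v \<in> words A (k + l)"
  by (auto simp: words_def)

lemma words_take: "w \<in> words A k \<Longrightarrow> l \<le> k \<Longrightarrow> take l w \<in> words A l"
  by (auto simp: words_def dest: in_set_takeD)

lemma words_drop: "w \<in> words A k \<Longrightarrow> drop l w \<in> words A (k - l)"
  by (auto simp: words_def dest: in_set_dropD)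

lemma words_0 [simp]: "words A 0 = {[]}"
  by (auto simp: words_def)

lemma words_Suc: "words A (Suc k) = (\<lambda>(a, w). a # w) ` (A \<times> words A k)"
  by (auto simp: words_def length_Suc_conv image_def)

lemma words_nonempty: "A \<noteq> {} \<Longrightarrow> words A k \<noteq> {}"
  by (induction k) (auto simp: words_Suc)

section \<open>Digit strings, their values and carries\<close>

definition digval :: "nat \<Rightarrow> nat list \<Rightarrow> nat" where
  "digval b xs = foldl (\<lambda>a d. a * b + d) 0 xs"

lemma digval_Nil [simp]: "digval b [] = 0"
  by (simp add: digval_def)

lemma digval_snoc: "digval b (xs @ [x]) = digval b xs * b + x"
  by (simp add: digval_def)

lemma digval_single [simp]: "digval b [x] = x"
  by (simp add: digval_def)

lemma digval_append: "digval b (xs @ ys) = digval b xs * b ^ length ys + digval b ys"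
proof (induction ys rule: rev_induct)
  case (snoc y ys)
  show ?case
    by (metis (no_types, lifting) digval_snoc snoc append_assoc length_append_singleton power_Suc2
        add_mult_distrib mult.assoc add.assoc)
qed simp

lemma digval_Cons: "digval b (x # ys) = x * b ^ length ys + digval b ys"
  using digval_append[of b "[x]" ys] by simp

lemma digval_less:
  assumes "set xs \<subseteq> {..<b}"
  shows "digval b xs < b ^ length xs"
  using assms
proof (induction xs)
  case (Cons x xs)
  then have "digval b (x # xs) < x * b ^ length xs + b ^ length xs"
    by (simp add: digval_Cons)
  also have "\<dots> = (x + 1) * b ^ length xs" by simp
  also have "\<dots> \<le> b * b ^ length xs"
    using Cons.prems by (intro mult_le_mono1) auto
  finally show ?case by simp
qed simp

lemma digval_inj:
  assumes "length xs = length ys" "set xs \<subseteq> {..<b}" "set ys \<subseteq> {..<b}" "digval b xs = digval b ys"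
  shows "xs = ys"
  using assms
proof (induction xs ys rule: rev_induct2)
  case (4 x xs y ys)
  have *: "x < b" "y < b" using 4 by auto
  have "(digval b xs * b + x) mod b = (digval b ys * b + y) mod b"
    using 4 by (simp add: digval_snoc)
  hence "x = y" using * by simp
  moreover have "digval b xs = digval b ys"
    using 4 \<open>x = y\<close> * by (auto simp: digval_snoc)
  ultimately show ?case using 4 by auto
qed auto

text \<open>The most significant digit comes first, so cutting off digits at the end is integer
  division. For \<open>t\<close> beyond the length, truncated subtraction yields the empty prefix
  and both sides are 0.\<close>

lemma digval_take:
  assumes "set xs \<subseteq> {..<b}"
  shows "digval b (take (length xs - t) xs) = digval b xs div b ^ t"
proof (cases "t \<le> length xs")
  case True
  let ?u = "take (length xs - t) xs" and ?v = "drop (length xs - t) xs"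
  have len: "length ?v = t" using True by simp
  have "digval b ?v < b ^ t"
    using digval_less[of ?v b] assms set_drop_subset[of "length xs - t" xs] len by auto
  moreover have "digval b xs = digval b ?u * b ^ t + digval b ?v"
    using digval_append[of b ?u ?v] len by simp
  ultimately show ?thesis
    by (metis add.right_neutral add.commute div_less div_mult_self3 gr_implies_not_zero)
next
  case False
  have "digval b xs < b ^ length xs" using assms by (rule digval_less)
  show ?thesis
  proof (cases "xs = []")
    case False
    hence "b > 0" using assms by (cases xs) auto
    hence "b ^ length xs \<le> b ^ t" using \<open>\<not> t \<le> length xs\<close> by (intro power_increasing) auto
    with \<open>digval b xs < b ^ length xs\<close> show ?thesis using \<open>\<not> t \<le> length xs\<close> by simp
  qed simp
qed

text \<open>Adding one with carry, read off from the last digit: below \<open>b - 1\<close> it is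
  raised and \<open>q = 0\<close>; otherwise it becomes 0 and the carry moves one place to the left,
  where the induction hypothesis applies.\<close>

lemma digval_consecutive:
  assumes "length xs = length ys" "set xs \<subseteq> {..<b}" "set ys \<subseteq> {..<b}"
    and "digval b ys = Suc (digval b xs)"
  shows "\<exists>us j q. xs = us @ j # replicate q (b - 1) \<and> ys = us @ Suc j # replicate q 0"
  using assms
proof (induction xs ys rule: rev_induct2)
  case (4 x xs y ys)
  have xy: "x < b" "y < b" using 4 by auto
  have eq: "digval b ys * b + y = digval b xs * b + Suc x"
    using 4 by (simp add: digval_snoc)
  show ?case
  proof (cases "Suc x = b")
    case True
    have eq': "digval b ys * b + y = Suc (digval b xs) * b" using eq True by simp
    have "(digval b ys * b + y) mod b = 0" unfolding eq' by simp
    hence "y = 0" using xy by simp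
    moreover have "digval b ys = Suc (digval b xs)"
      using eq' \<open>y = 0\<close> xy by (metis add.right_neutral mult_cancel2 not_less_zero)
    then obtain us j q where "xs = us @ j # replicate q (b - 1)" "ys = us @ Suc j # replicate q 0"
      using 4 by auto
    moreover have "x = b - 1" using True by simp
    ultimately have "xs @ [x] = us @ j # replicate (Suc q) (b - 1) \<and>
        ys @ [y] = us @ Suc j # replicate (Suc q) 0"
      by (simp add: replicate_append_same)
    thus ?thesis by blast
  next
    case False
    hence sx: "Suc x < b" using xy by simp
    have "(digval b ys * b + y) mod b = (digval b xs * b + Suc x) mod b" using eq by simp
    hence y: "y = Suc x" using sx xy by simp
    hence "digval b ys = digval b xs" using eq xy by auto
    hence "ys = xs" using 4 by (intro digval_inj) auto
    hence "xs @ [x] = xs @ x # replicate 0 (b - 1) \<and> ys @ [y] = xs @ Suc x # replicate 0 0"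
      using y by simp
    thus ?thesis by blast
  qed
qed auto

section \<open>Products of fiber sizes along row words, and their change under a carry\<close>

definition rowprod :: "(nat \<Rightarrow> nat) \<Rightarrow> nat list \<Rightarrow> nat" where
  "rowprod a ys = prod_list (map a ys)"

lemma rowprod_simps [simp]:
  "rowprod a [] = 1" "rowprod a (y # ys) = a y * rowprod a ys"
  "rowprod a (xs @ ys) = rowprod a xs * rowprod a ys"
  "rowprod a (replicate q b) = a b ^ q"
  by (simp_all add: rowprod_def prod_list_replicate)

lemma rowprod_pos: "\<forall>y\<in>set ys. 0 < a y \<Longrightarrow> 0 < rowprod a ys"
  by (induction ys) auto

lemma rowprod_le: "\<forall>y\<in>set ys. a y \<le> c \<Longrightarrow> rowprod a ys \<le> c ^ length ys"
  by (induction ys) (auto intro: mult_le_mono)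

lemma rowprod_le': "\<forall>y\<in>set ys. a y \<le> c \<Longrightarrow> 0 < c \<Longrightarrow> length ys \<le> t \<Longrightarrow> rowprod a ys \<le> c ^ t"
  using rowprod_le[of ys a c] power_increasing[of "length ys" t c] by force

text \<open>The rows from \<open>us\<close> are common. Besides its run, \<open>ys\<close> has one
  digit and a tail of length at most \<open>t\<close>, contributing at most
  \<open>c ^ Suc t\<close>; the corresponding part of \<open>zs\<close> contributes at least 1. Both
  runs start at the same place and have equal length, so the same number \<open>e\<close> of their
  digits survives \<open>drop l\<close>. The quotient \<open>(a b / a b') ^ e\<close> is
  cross-multiplied to stay in the natural numbers.\<close>

lemma carry_rows:
  assumes ys: "ys = us @ j # replicate q b @ y2" and zs: "zs = us @ j' # replicate q b' @ z2"
    and pos: "\<forall>y\<in>set ys \<union> set zs. 0 < a y \<and> a y \<le> c" and "0 < c" and "length y2 \<le> t"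
  shows "\<exists>e s s' r r'. drop l ys = s @ replicate e b @ s' \<and> drop l zs = r @ replicate e b' @ r' \<and>
           rowprod a (drop l ys) * a b' ^ e \<le> c ^ Suc t * rowprod a (drop l zs) * a b ^ e"
proof -
  \<comment> \<open>Once \<open>us\<close> is exhausted, \<open>i\<close> letters are still to be
    dropped: first the digit \<open>j\<close> or \<open>j'\<close>, then letters of the run, and the
    last \<open>i2\<close> from the tail. For \<open>i = 0\<close> truncated subtraction leaves
    digit and run whole.\<close>
  define i where "i = l - length us"
  define e where "e = q - (i - 1)"
  define i2 where "i2 = i - 1 - q"
  define s where "s = drop l us @ drop i [j]"
  define r where "r = drop l us @ drop i [j']"
  have 1: "drop l ys = s @ replicate e b @ drop i2 y2"
    by (simp add: ys s_def e_def i2_def i_def drop_Cons' )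
  have 2: "drop l zs = r @ replicate e b' @ drop i2 z2"
    by (simp add: zs r_def e_def i2_def i_def drop_Cons')
  have a1: "rowprod a (drop i [j]) \<le> c"
    using pos ys \<open>0 < c\<close> by (cases i) auto
  have a2: "rowprod a (drop i2 y2) \<le> c ^ t"
    using pos ys \<open>0 < c\<close> \<open>length y2 \<le> t\<close> by (intro rowprod_le') (auto dest: in_set_dropD)
  have a3: "1 \<le> rowprod a (drop i [j'])"
    using pos zs by (cases i) auto
  have "\<forall>y\<in>set (drop i2 z2). 0 < a y"
    using pos zs by (auto dest: in_set_dropD)
  hence a4: "1 \<le> rowprod a (drop i2 z2)"
    using rowprod_pos by (simp add: Suc_leI)
  let ?u = "rowprod a (drop l us)"
  have "rowprod a (drop l ys) * a b' ^ e
      = ?u * a b ^ e * a b' ^ e * (rowprod a (drop i [j]) * rowprod a (drop i2 y2))"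
    unfolding 1 s_def by (simp add: algebra_simps)
  also have "\<dots> \<le> ?u * a b ^ e * a b' ^ e * (c * c ^ t)"
    by (intro mult_le_mono a1 a2 le_refl)
  also have "\<dots> = ?u * a b ^ e * a b' ^ e * (c * c ^ t) * (1 * 1)" by simp
  also have "\<dots> \<le> ?u * a b ^ e * a b' ^ e * (c * c ^ t) *
      (rowprod a (drop i [j']) * rowprod a (drop i2 z2))"
    by (intro mult_le_mono a3 a4 le_refl)
  also have "\<dots> = c ^ Suc t * rowprod a (drop l zs) * a b ^ e"
    unfolding 2 r_def by (simp add: algebra_simps)
  finally show ?thesis using 1 2 by blast
qed

lemma common_prefix_rows:
  assumes "ys = x @ y2" "zs = x @ z2"
    and pos: "\<forall>y\<in>set ys \<union> set zs. 0 < a y \<and> a y \<le> c" and "0 < c" and "length y2 \<le> t"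
  shows "rowprod a (drop l ys) \<le> c ^ t * rowprod a (drop l zs)"
proof -
  have "\<forall>y\<in>set (drop (l - length x) z2). 0 < a y"
    using pos assms(2) by (auto dest: in_set_dropD)
  hence pz: "1 \<le> rowprod a (drop (l - length x) z2)"
    using rowprod_pos by (simp add: Suc_leI)
  have "\<forall>y\<in>set (drop (l - length x) y2). a y \<le> c"
    using pos assms(1) by (auto dest: in_set_dropD)
  hence py: "rowprod a (drop (l - length x) y2) \<le> c ^ t"
    using \<open>0 < c\<close> \<open>length y2 \<le> t\<close> by (intro rowprod_le') auto
  have "rowprod a (drop l ys) = rowprod a (drop l x) * rowprod a (drop (l - length x) y2) * 1"
    using assms by simp
  also have "\<dots> \<le> rowprod a (drop l x) * c ^ t * rowprod a (drop (l - length x) z2)"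
    by (intro mult_le_mono le_refl py pz)
  also have "\<dots> = c ^ t * rowprod a (drop l zs)"
    using assms by (simp add: algebra_simps)
  finally show ?thesis .
qed

text \<open>Without their last \<open>t\<close> digits the two values differ by at most 1, so the
  truncated words agree or differ by a carry. A carry exchanges a run of \<open>m - 1\<close> for a
  run of 0 and passes through two consecutive rows that both occur, whence the clause on
  \<open>0 < e\<close>. The cut digits and the digit at the carry cost
  \<open>c ^ Suc t\<close>.\<close>

lemma near_rows:
  assumes "length ys = length zs"
    and pos: "\<forall>y\<in>set ys \<union> set zs. 0 < a y \<and> a y \<le> c \<and> y < m" and "0 < c"
    and near: "\<bar>int (digval m ys) - int (digval m zs)\<bar> < int (m ^ t)"
  shows "\<exists>b b' e s s' r r'. (b, b') \<in> {(0, m - 1), (m - 1, 0)} \<and>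
           drop l ys = s @ replicate e b @ s' \<and> drop l zs = r @ replicate e b' @ r' \<and>
           (0 < e \<longrightarrow> (\<exists>j. Suc j < m \<and> 0 < a j \<and> 0 < a (Suc j))) \<and>
           rowprod a (drop l ys) * a b' ^ e \<le> c ^ Suc t * rowprod a (drop l zs) * a b ^ e"
proof -
  define k where "k = length ys - t"
  have k': "k = length zs - t" using assms by (simp add: k_def)
  define y1 y2 z1 z2 where defs: "y1 = take k ys" "y2 = drop k ys" "z1 = take k zs" "z2 = drop k zs"
  have split: "ys = y1 @ y2" "zs = z1 @ z2" by (simp_all add: defs)
  have l2: "length y2 \<le> t" "length z2 \<le> t" unfolding defs by (auto simp: k_def assms(1))
  have l1: "length y1 = length z1" unfolding defs by (simp add: assms(1))
  have sub: "set ys \<subseteq> {..<m}" "set zs \<subseteq> {..<m}" using pos by auto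
  have sub1: "set y1 \<subseteq> {..<m}" "set z1 \<subseteq> {..<m}" using sub split by auto
  have v: "digval m y1 = digval m ys div m ^ t" "digval m z1 = digval m zs div m ^ t"
    unfolding defs using digval_take[OF sub(1), of t] digval_take[OF sub(2), of t]
    by (simp_all add: k_def assms(1))
  have step: "x div d \<le> Suc (y div d)" if "\<bar>int x - int y\<bar> < int d" for x y d :: nat
  proof -
    have "x \<le> y + d" using that by linarith
    hence "x div d \<le> (y + d) div d" by (rule div_le_mono)
    thus ?thesis using that by (cases "d = 0") auto
  qed
  have "digval m y1 \<le> Suc (digval m z1)" "digval m z1 \<le> Suc (digval m y1)"
    unfolding v using near by (intro step; simp)+
  then consider "digval m y1 = digval m z1" | "digval m z1 = Suc (digval m y1)"
    | "digval m y1 = Suc (digval m z1)" by linarith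
  thus ?thesis
  proof cases
    case 1
    hence eq: "z1 = y1" using digval_inj[OF l1 sub1] by simp
    have "rowprod a (drop l ys) \<le> c ^ t * rowprod a (drop l zs)"
      by (rule common_prefix_rows[of ys y1 y2 zs z2]) (use pos \<open>0 < c\<close> l2 split eq in auto)
    also have "\<dots> \<le> c ^ Suc t * rowprod a (drop l zs)" using \<open>0 < c\<close> by simp
    \<comment> \<open>Equal prefixes: with a run of length 0 either order of the end digits will
      do.\<close>
    finally show ?thesis
      by (rule_tac x = 0 in exI, rule_tac x = "m - 1" in exI, rule_tac x = 0 in exI,
          rule_tac x = "drop l ys" in exI, rule_tac x = "[]" in exI,
          rule_tac x = "drop l zs" in exI, rule_tac x = "[]" in exI) simp
  next
    case 2
    then obtain us j q where *: "y1 = us @ j # replicate q (m - 1)" "z1 = us @ Suc j # replicate q 0"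
      using digval_consecutive[OF l1 sub1] by auto
    have "j \<in> set ys \<union> set zs" "Suc j \<in> set ys \<union> set zs" by (simp_all add: split *)
    hence adj: "\<exists>j. Suc j < m \<and> 0 < a j \<and> 0 < a (Suc j)" using pos by blast
    have "\<exists>e s s' r r'. drop l ys = s @ replicate e (m - 1) @ s' \<and>
           drop l zs = r @ replicate e 0 @ r' \<and>
           rowprod a (drop l ys) * a 0 ^ e \<le> c ^ Suc t * rowprod a (drop l zs) * a (m - 1) ^ e"
    proof (rule carry_rows)
      show "ys = us @ j # replicate q (m - 1) @ y2" "zs = us @ Suc j # replicate q 0 @ z2"
        by (simp_all add: split *)
      show "\<forall>y\<in>set ys \<union> set zs. 0 < a y \<and> a y \<le> c" using pos by blast
    qed fact+
    then obtain e s s' r r' where "drop l ys = s @ replicate e (m - 1) @ s'"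
        "drop l zs = r @ replicate e (0) @ r'"
        "rowprod a (drop l ys) * a (0) ^ e \<le> c ^ Suc t * rowprod a (drop l zs) * a (m - 1) ^ e"
      by (elim exE conjE) (rule that)
    with adj show ?thesis
      by (rule_tac x = "m - 1" in exI, rule_tac x = "0" in exI, rule_tac x = e in exI,
          rule_tac x = s in exI, rule_tac x = s' in exI,
          rule_tac x = r in exI, rule_tac x = r' in exI) simp
  next
    case 3
    then obtain us j q where *: "z1 = us @ j # replicate q (m - 1)" "y1 = us @ Suc j # replicate q 0"
      using digval_consecutive[OF l1[symmetric] sub1(2,1)] by auto
    have "j \<in> set ys \<union> set zs" "Suc j \<in> set ys \<union> set zs" by (simp_all add: split *)
    hence adj: "\<exists>j. Suc j < m \<and> 0 < a j \<and> 0 < a (Suc j)" using pos by blast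
    have "\<exists>e s s' r r'. drop l ys = s @ replicate e 0 @ s' \<and>
           drop l zs = r @ replicate e (m - 1) @ r' \<and>
           rowprod a (drop l ys) * a (m - 1) ^ e \<le> c ^ Suc t * rowprod a (drop l zs) * a 0 ^ e"
    proof (rule carry_rows)
      show "ys = us @ Suc j # replicate q 0 @ y2" "zs = us @ j # replicate q (m - 1) @ z2"
        by (simp_all add: split *)
      show "\<forall>y\<in>set ys \<union> set zs. 0 < a y \<and> a y \<le> c" using pos by blast
    qed fact+
    then obtain e s s' r r' where "drop l ys = s @ replicate e (0) @ s'"
        "drop l zs = r @ replicate e (m - 1) @ r'"
        "rowprod a (drop l ys) * a (m - 1) ^ e \<le> c ^ Suc t * rowprod a (drop l zs) * a (0) ^ e"
      by (elim exE conjE) (rule that)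
    with adj show ?thesis
      by (rule_tac x = "0" in exI, rule_tac x = "m - 1" in exI, rule_tac x = e in exI,
          rule_tac x = s in exI, rule_tac x = s' in exI,
          rule_tac x = r in exI, rule_tac x = r' in exI) simp
  qed
qed

section \<open>The number of letters whose column is visible at level k\<close>

definition ell :: "nat \<Rightarrow> nat \<Rightarrow> nat \<Rightarrow> nat" where
  "ell n m k = (GREATEST l. n ^ l \<le> m ^ k)"

text \<open>With l = \<open>ell n m k\<close>, the integer part of k log m / log n, a rectangle of
  width n^-l and height m^-k is a square up to the factor \<open>n\<close>. Every admissible
  exponent is at most \<open>k\<close>, which makes \<open>GREATEST\<close> meaningful.\<close>

lemma ell_bounds:
  assumes "2 \<le> m" "m < n"
  shows "n ^ ell n m k \<le> m ^ k" "m ^ k < n ^ Suc (ell n m k)" "ell n m k \<le> k"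
proof -
  have b: "l \<le> k" if "n ^ l \<le> m ^ k" for l
  proof -
    have "n ^ l \<le> n ^ k" using that power_mono[of m n k] assms by linarith
    thus ?thesis using assms by (simp add: power_increasing_iff)
  qed
  show 1: "n ^ ell n m k \<le> m ^ k"
    unfolding ell_def by (rule GreatestI_nat[where k = 0 and b = k]) (use b assms in auto)
  show "ell n m k \<le> k" using b[OF 1] .
  show "m ^ k < n ^ Suc (ell n m k)"
  proof (rule ccontr)
    assume "\<not> ?thesis"
    hence "n ^ Suc (ell n m k) \<le> m ^ k" by simp
    hence "Suc (ell n m k) \<le> ell n m k"
      unfolding ell_def by (rule Greatest_le_nat[where b = k]) (use b in auto)
    thus False by simp
  qed
qed

lemma ell_ge: "2 \<le> m \<Longrightarrow> m < n \<Longrightarrow> n ^ l \<le> m ^ k \<Longrightarrow> l \<le> ell n m k"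
  using ell_bounds(2)[of m n k] power_less_imp_less_exp[of n l "Suc (ell n m k)"] by auto

lemma ell_mono:
  assumes "2 \<le> m" "m < n" "k \<le> k'"
  shows "ell n m k \<le> ell n m k'"
  using assms by (intro ell_ge order_trans[OF ell_bounds(1) power_increasing]) auto

lemma ell_unbounded:
  assumes "2 \<le> m" "m < n"
  shows "\<exists>K. l \<le> ell n m K"
proof -
  have "n ^ l \<le> 2 ^ (n ^ l)" by (simp add: less_exp less_imp_le)
  also have "\<dots> \<le> m ^ (n ^ l)" using assms by (intro power_mono) auto
  finally show ?thesis using assms by (blast intro: ell_ge)
qed

lemma filterlim_ell:
  assumes "2 \<le> m" "m < n"
  shows "filterlim (ell n m) at_top sequentially"
  unfolding filterlim_at_top eventually_sequentially
  by (meson assms ell_mono ell_unbounded order_trans)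

text \<open>If k - l <= c, then n^k <= n^c n^l <= n^c m^k, so (n/m)^k is at most n^c; this fails for
  large k because m < n.\<close>

lemma filterlim_minus_ell:
  assumes "2 \<le> m" "m < n"
  shows "filterlim (\<lambda>k. k - ell n m k) at_top sequentially"
  unfolding filterlim_at_top
proof
  fix c :: nat
  have "1 < real n / real m" using assms by simp
  then obtain k0 where k0: "real n ^ c < (real n / real m) ^ k0"
    using real_arch_pow by blast
  have "\<forall>\<^sub>F k in sequentially. real n ^ c < (real n / real m) ^ k"
    using eventually_ge_at_top[of k0]
  proof eventually_elim
    case (elim k)
    have "(real n / real m) ^ k0 \<le> (real n / real m) ^ k"
      using elim \<open>1 < real n / real m\<close> by (intro power_increasing) auto
    with k0 show ?case by simp
  qed
  thus "\<forall>\<^sub>F k in sequentially. c \<le> k - ell n m k"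
  proof eventually_elim
    case (elim k)
    show ?case
    proof (rule ccontr)
      assume "\<not> ?thesis"
      hence "k \<le> c + ell n m k" by simp
      hence "n ^ k \<le> n ^ c * n ^ ell n m k"
        using assms by (simp add: power_add[symmetric])
      also have "\<dots> \<le> n ^ c * m ^ k" using ell_bounds[OF assms] by simp
      finally have "real n ^ k \<le> real n ^ c * real m ^ k"
        by (metis of_nat_le_iff of_nat_mult of_nat_power)
      with elim assms show False by (simp add: power_divide field_simps)
    qed
  qed
qed

section \<open>Cells and their masses\<close>

text \<open>For \<open>l = ell n m k\<close> the key of a word of length \<open>k\<close> is the approximate square of side about
  \<open>m\<close> to the power \<open>-k\<close> that contains its cylinder.\<close>

definition key :: "nat \<Rightarrow> (nat \<times> nat) list \<Rightarrow> (nat \<times> nat) list \<times> nat list" where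
  "key l w = (take l w, drop l (map snd w))"

text \<open>The two numbers compared are the grid coordinates of the approximate square of a word:
  the column index sees only the first \<open>ell\<close> letters, the row index sees all. This
  stands for Euclidean distance of order B m^-k; \<open>near_imp_dist\<close> and
  \<open>dist_imp_near\<close> make that precise.\<close>

definition near :: "nat \<Rightarrow> nat \<Rightarrow> nat \<Rightarrow> (nat \<times> nat) list \<Rightarrow> (nat \<times> nat) list \<Rightarrow> bool" where
  "near n m B w v \<longleftrightarrow>
     \<bar>int (digval n (map fst (take (ell n m (length w)) w))) -
      int (digval n (map fst (take (ell n m (length v)) v)))\<bar> \<le> int B \<and>
     \<bar>int (digval m (map snd w)) - int (digval m (map snd v))\<bar> \<le> int B"

lemma near_refl [simp]: "near n m B w w"
  by (simp add: near_def)

lemma near_sym: "near n m B w v \<Longrightarrow> near n m B v w"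
  by (auto simp: near_def abs_minus_commute)

lemma near_trans: "near n m B u v \<Longrightarrow> near n m B' v w \<Longrightarrow> near n m (B + B') u w"
  unfolding near_def by linarith

lemma card_image_le_of_determines:
  assumes "finite (g ` S)" and "\<And>x y. x \<in> S \<Longrightarrow> y \<in> S \<Longrightarrow> g x = g y \<Longrightarrow> f x = f y"
  shows "finite (f ` S)" "card (f ` S) \<le> card (g ` S)"
proof -
  define h where "h z = f (SOME x. x \<in> S \<and> g x = z)" for z
  have "h (g x) = f x" if "x \<in> S" for x
    unfolding h_def by (metis (mono_tags, lifting) assms(2) someI_ex that)
  hence "f ` S = h ` (g ` S)" by (force simp: image_image)
  thus "finite (f ` S)" "card (f ` S) \<le> card (g ` S)"
    using assms(1) by (auto intro: card_image_le)
qed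

locale digit_set =
  fixes n m :: nat and D :: "(nat \<times> nat) set"
  assumes m_ge: "2 \<le> m" and m_less: "m < n"
    and D_sub: "D \<subseteq> {0..<n} \<times> {0..<m}" and D_nonempty: "D \<noteq> {}"
begin

abbreviation rows :: "nat set" where "rows \<equiv> snd ` D"

abbreviation lev :: "nat \<Rightarrow> nat" where "lev \<equiv> ell n m"

text \<open>For \<open>l = lev k\<close> this is the number of words of length \<open>k\<close> in
  the approximate square of \<open>w\<close> (\<open>card_same_key\<close>); divided by
  \<open>card D ^ k\<close> it is the combinatorial form of the measure of that square.\<close>

definition mass :: "nat \<Rightarrow> (nat \<times> nat) list \<Rightarrow> nat" where
  "mass l w = rowprod (fiber D) (drop l (map snd w))"

lemma finite_D: "finite D"
  using D_sub by (rule finite_subset) auto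

lemma card_D_pos: "0 < card D"
  using finite_D D_nonempty by (simp add: card_gt_0_iff)

lemma lev_le: "lev k \<le> k"
  using ell_bounds(3)[OF m_ge m_less] .

lemma card_row: "card {d \<in> D. snd d = y} = fiber D y"
proof -
  have "{d \<in> D. snd d = y} = (\<lambda>i. (i, y)) ` {i. (i, y) \<in> D}" by force
  thus ?thesis unfolding fiber_def by (simp add: card_image inj_on_def)
qed

lemma fiber_pos: "j \<in> rows \<longleftrightarrow> 0 < fiber D j"
proof -
  have "j \<in> rows \<longleftrightarrow> {d \<in> D. snd d = j} \<noteq> {}" by blast
  thus ?thesis using finite_D by (simp add: card_row[symmetric] card_gt_0_iff)
qed

lemma fiber_le: "fiber D j \<le> n"
proof -
  have "{i. (i, j) \<in> D} \<subseteq> {0..<n}" using D_sub by auto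
  from card_mono[OF _ this] show ?thesis by (simp add: fiber_def)
qed

lemma n_pos: "0 < n" using m_ge m_less by simp

lemma row_less: "j \<in> rows \<Longrightarrow> j < m"
  using D_sub by auto

lemma fst_digits: "w \<in> words D k \<Longrightarrow> set (map fst w) \<subseteq> {..<n}"
  using D_sub by (auto simp: words_def)

lemma snd_digits: "w \<in> words D k \<Longrightarrow> set (map snd w) \<subseteq> {..<m}"
  using D_sub by (auto simp: words_def)

lemma snd_word: "w \<in> words D k \<Longrightarrow> map snd w \<in> words rows k"
  by (auto simp: words_def)

lemma words_row_fiber: "ys \<in> words rows k \<Longrightarrow> \<forall>y\<in>set ys. 0 < fiber D y \<and> fiber D y \<le> n \<and> y < m"
  using fiber_pos fiber_le row_less by (auto simp: words_def subset_iff)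

lemma mass_pos: "w \<in> words D k \<Longrightarrow> 0 < mass l w"
  unfolding mass_def using words_row_fiber[OF snd_word, of w k]
  by (intro rowprod_pos) (meson in_set_dropD)

lemma card_words_over_rows: "card {x \<in> words D (length ys). map snd x = ys} = rowprod (fiber D) ys"
proof (induction ys)
  case Nil
  have "{x \<in> words D 0. map snd x = []} = {[]}" by auto
  thus ?case by simp
next
  case (Cons y ys)
  have eq: "{x \<in> words D (length (y # ys)). map snd x = y # ys} =
      (\<lambda>(d, x). d # x) ` ({d \<in> D. snd d = y} \<times> {x \<in> words D (length ys). map snd x = ys})"
    by (auto simp: words_Suc image_iff)
  show ?case
    unfolding eq by (subst card_image) (auto simp: inj_on_def card_cartesian_product card_row Cons)
qed

lemma card_same_key:
  assumes "w \<in> words D k" "l \<le> k"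
  shows "card {u \<in> words D k. key l u = key l w} = mass l w"
proof -
  let ?ys = "drop l (map snd w)"
  have len: "length ?ys = k - l" "length (take l w) = l"
    using assms by (auto simp: words_def)
  have tl: "take l w \<in> words D l" using assms by (rule words_take)
  have "{u \<in> words D k. key l u = key l w} =
      (\<lambda>x. take l w @ x) ` {x \<in> words D (length ?ys). map snd x = ?ys}" (is "?A = ?B")
  proof (intro equalityI subsetI)
    fix u assume u: "u \<in> ?A"
    hence "u = take l w @ drop l u" by (metis (mono_tags, lifting) append_take_drop_id fst_conv key_def mem_Collect_eq)
    moreover have "drop l u \<in> words D (length ?ys)" using u words_drop len by auto
    moreover have "map snd (drop l u) = ?ys" using u by (auto simp: key_def drop_map)
    ultimately show "u \<in> ?B" by blast
  next
    fix u assume "u \<in> ?B"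
    then obtain x where x: "u = take l w @ x" "x \<in> words D (k - l)" "map snd x = ?ys"
      using len by auto
    hence "u \<in> words D k" using words_append[OF tl x(2)] assms by simp
    thus "u \<in> ?A" using x len by (simp add: key_def)
  qed
  moreover have "card ?B = card {x \<in> words D (length ?ys). map snd x = ?ys}"
    by (rule card_image) (simp add: inj_on_def)
  ultimately show ?thesis by (simp only: card_words_over_rows mass_def)
qed

lemma key_image:
  assumes "l \<le> k"
  shows "key l ` words D k = words D l \<times> words rows (k - l)"
proof (intro equalityI subsetI)
  fix z assume "z \<in> key l ` words D k"
  thus "z \<in> words D l \<times> words rows (k - l)"
    using assms words_take words_drop[OF snd_word] by (auto simp: key_def)
next
  fix z assume "z \<in> words D l \<times> words rows (k - l)"
  then obtain p y where z: "z = (p, y)" "p \<in> words D l" "y \<in> words rows (k - l)" by auto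
  have "rowprod (fiber D) y > 0"
    using words_row_fiber[OF z(3)] by (intro rowprod_pos) auto
  hence "{x \<in> words D (length y). map snd x = y} \<noteq> {}"
    using card_words_over_rows[of y] by (metis card.empty less_numeral_extra(3))
  then obtain x where x: "x \<in> words D (k - l)" "map snd x = y"
    using z(3) by (auto simp: words_def)
  have "key l (p @ x) = z" using z x by (auto simp: key_def words_def)
  moreover have "p @ x \<in> words D k" using words_append[OF z(2) x(1)] assms by simp
  ultimately show "z \<in> key l ` words D k" by blast
qed

text \<open>The letters of a finer cell fall into four ranges: below \<open>l\<close> they are those
  of \<open>w\<close>; from \<open>l\<close> to \<open>k\<close> the row is prescribed and the
  column free, \<open>mass l w\<close> choices in all; from \<open>k\<close> to \<open>l'\<close>
  any letter of \<open>D\<close> may stand; from \<open>l'\<close> to \<open>K\<close> only the row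
  is recorded.\<close>

lemma card_subcells:
  assumes "w \<in> words D k" "l \<le> k" "k \<le> l'" "l' \<le> K"
  shows "card (key l' ` {u \<in> words D K. key l (take k u) = key l w}) =
    mass l w * card D ^ (l' - k) * card rows ^ (K - l')"
proof -
  let ?A = "{p \<in> words D l'. key l (take k p) = key l w}"
  have "key l' ` {u \<in> words D K. key l (take k u) = key l w} = ?A \<times> words rows (K - l')"
  proof (intro equalityI subsetI)
    fix z assume "z \<in> key l' ` {u \<in> words D K. key l (take k u) = key l w}"
    then obtain u where u: "u \<in> words D K" "key l (take k u) = key l w" "z = key l' u" by auto
    have "z \<in> words D l' \<times> words rows (K - l')" using key_image[OF assms(4)] u by blast
    moreover have "fst z = take l' u" using u by (simp add: key_def)
    moreover have "take k (take l' u) = take k u" using assms by (simp add: min_def)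
    ultimately have "key l (take k (fst z)) = key l w" using u by metis
    with \<open>z \<in> words D l' \<times> words rows (K - l')\<close> show "z \<in> ?A \<times> words rows (K - l')" by auto
  next
    fix z assume z: "z \<in> ?A \<times> words rows (K - l')"
    hence "z \<in> key l' ` words D K" using key_image[OF assms(4)] by auto
    then obtain u where u: "u \<in> words D K" "z = key l' u" by auto
    have "take k u = take k (take l' u)" using assms by (simp add: min_def)
    moreover have "fst z = take l' u" using u by (simp add: key_def)
    moreover have "key l (take k (fst z)) = key l w" using z by auto
    ultimately have "key l (take k u) = key l w" by metis
    thus "z \<in> key l' ` {u \<in> words D K. key l (take k u) = key l w}" using u by blast
  qed
  moreover have "card ?A = mass l w * card D ^ (l' - k)"
  proof -
    have "?A = (\<lambda>(x, y). x @ y) ` ({u \<in> words D k. key l u = key l w} \<times> words D (l' - k))"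
    proof (intro equalityI subsetI)
      fix p assume p: "p \<in> ?A"
      have "take k p \<in> words D k" "drop k p \<in> words D (l' - k)"
        using p assms words_take words_drop by auto
      thus "p \<in> (\<lambda>(x, y). x @ y) ` ({u \<in> words D k. key l u = key l w} \<times> words D (l' - k))"
        using p by (intro image_eqI[of _ _ "(take k p, drop k p)"]) auto
    next
      fix p assume "p \<in> (\<lambda>(x, y). x @ y) ` ({u \<in> words D k. key l u = key l w} \<times> words D (l' - k))"
      then obtain x y where xy: "p = x @ y" "x \<in> words D k" "key l x = key l w" "y \<in> words D (l' - k)"
        by auto
      have "length x = k" using xy by (simp add: words_def)
      thus "p \<in> ?A" using words_append[OF xy(2,4)] xy assms by simp
    qed
    moreover have "inj_on (\<lambda>(x, y). x @ y) ({u \<in> words D k. key l u = key l w} \<times> words D (l' - k))"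
      by (auto simp: inj_on_def words_def)
    ultimately show ?thesis
      using card_same_key[OF assms(1,2)] finite_D
      by (simp add: card_image card_cartesian_product card_words)
  qed
  ultimately show ?thesis
    using finite_D by (simp add: card_cartesian_product card_words)
qed

lemma card_all_cells:
  assumes "l' \<le> K"
  shows "card (key l' ` words D K) = card D ^ l' * card rows ^ (K - l')"
  using finite_D unfolding key_image[OF assms] by (simp add: card_cartesian_product card_words)

text \<open>Equal row indices give equal row words, equal column indices equal columns of the first
  letters. Being in the same cell thus becomes the case \<open>B = 0\<close> of \<open>near\<close>,
  to which \<open>near_trans\<close> applies.\<close>

lemma near_0_key:
  assumes "w \<in> words D k" "v \<in> words D k"
  shows "near n m 0 w v \<longleftrightarrow> key (lev k) w = key (lev k) v"
proof
  assume near: "near n m 0 w v"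
  have len: "length w = k" "length v = k" using assms by (auto simp: words_def)
  have s: "map snd w = map snd v"
    using near assms len by (intro digval_inj[of _ _ m] snd_digits) (auto simp: near_def)
  have "map fst (take (lev k) w) = map fst (take (lev k) v)"
    using near len fst_digits[OF words_take[OF assms(1) lev_le]] fst_digits[OF words_take[OF assms(2) lev_le]]
    by (intro digval_inj[of _ _ n]) (auto simp: near_def)
  moreover have "map snd (take (lev k) w) = map snd (take (lev k) v)"
    using s by (metis take_map)
  ultimately have "take (lev k) w = take (lev k) v"
    by (metis zip_map_fst_snd)
  thus "key (lev k) w = key (lev k) v" using s by (simp add: key_def)
next
  assume key: "key (lev k) w = key (lev k) v"
  have len: "length w = k" "length v = k" using assms by (auto simp: words_def)
  have "map snd w = map snd (take (lev k) w) @ drop (lev k) (map snd w)"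
    by (metis append_take_drop_id take_map)
  also have "\<dots> = map snd v"
    using key by (simp add: key_def) (metis append_take_drop_id take_map)
  finally show "near n m 0 w v" using key len by (simp add: near_def key_def)
qed

text \<open>The two grid indices determine a cell, and here they lie in a box of side
  \<open>2 * B + 1\<close>.\<close>

lemma card_near_keys:
  assumes "S \<subseteq> words D k" and "\<And>u. u \<in> S \<Longrightarrow> near n m B u w0"
  shows "finite (key (lev k) ` S)" "card (key (lev k) ` S) \<le> (2 * B + 1) ^ 2"
proof -
  define X where "X w = int (digval n (map fst (take (lev (length w)) w)))" for w :: "(nat \<times> nat) list"
  define Y where "Y w = int (digval m (map snd w))" for w :: "(nat \<times> nat) list"
  have near: "near n m b u w \<longleftrightarrow> \<bar>X u - X w\<bar> \<le> int b \<and> \<bar>Y u - Y w\<bar> \<le> int b" for b u w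
    by (simp add: near_def X_def Y_def)
  let ?g = "\<lambda>w. (X w, Y w)"
  let ?box = "{X w0 - int B..X w0 + int B} \<times> {Y w0 - int B..Y w0 + int B}"
  have sub: "?g ` S \<subseteq> ?box" using assms(2) unfolding near by fastforce
  hence fin: "finite (?g ` S)" by (rule finite_subset) auto
  have "card (?g ` S) \<le> card ?box" by (rule card_mono[OF _ sub]) auto
  also have "card ?box = (2 * B + 1) ^ 2"
  proof -
    have "nat (x + int B - (x - int B) + 1) = 2 * B + 1" for x by simp
    thus ?thesis by (simp only: card_cartesian_product card_atLeastAtMost_int power2_eq_square)
  qed
  finally have le: "card (?g ` S) \<le> (2 * B + 1) ^ 2" .
  have "key (lev k) x = key (lev k) y" if "x \<in> S" "y \<in> S" "?g x = ?g y" for x y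
    using that assms(1) near_0_key[of x k y] by (auto simp: near)
  from card_image_le_of_determines[of ?g S "key (lev k)", OF fin this] le
  show "finite (key (lev k) ` S)" "card (key (lev k) ` S) \<le> (2 * B + 1) ^ 2" by auto
qed

text \<open>Neighbouring cells have comparable masses unless a carry run lies between them. This
  serves twice: to prove doubling when the criterion for carries fails, and to extract a run from a
  pair of very unequal neighbours.\<close>

lemma near_mass:
  assumes "w \<in> words D k" "u \<in> words D k" "near n m B w u" "B < m ^ t"
  shows "\<exists>b b' e s s' r r'. (b, b') \<in> {(0, m - 1), (m - 1, 0)} \<and>
           drop l (map snd w) = s @ replicate e b @ s' \<and> drop l (map snd u) = r @ replicate e b' @ r' \<and>
           (0 < e \<longrightarrow> (\<exists>j. Suc j < m \<and> 0 < fiber D j \<and> 0 < fiber D (Suc j))) \<and>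
           mass l w * fiber D b' ^ e \<le> n ^ Suc t * mass l u * fiber D b ^ e"
  unfolding mass_def
proof (rule near_rows)
  show "length (map snd w) = length (map snd u)" using assms by (auto simp: words_def)
  show "\<forall>y\<in>set (map snd w) \<union> set (map snd u). 0 < fiber D y \<and> fiber D y \<le> n \<and> y < m"
    using words_row_fiber[OF snd_word[OF assms(1)]] words_row_fiber[OF snd_word[OF assms(2)]] by blast
  show "0 < n" using m_less by simp
  have "int B < int (m ^ t)" using assms(4) by (simp del: of_nat_power)
  thus "\<bar>int (digval m (map snd w)) - int (digval m (map snd u))\<bar> < int (m ^ t)"
    using assms(3) unfolding near_def by linarith
qed

lemma sum_rowprod_power:
  "(\<Sum>ys\<in>words rows k. rowprod (fiber D) ys ^ q) = (\<Sum>j\<in>rows. fiber D j ^ q) ^ k"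
proof (induction k)
  case (Suc k)
  have "(\<Sum>ys\<in>words rows (Suc k). rowprod (fiber D) ys ^ q) =
      (\<Sum>(j, ys)\<in>rows \<times> words rows k. fiber D j ^ q * rowprod (fiber D) ys ^ q)"
    unfolding words_Suc
    by (subst sum.reindex) (auto simp: inj_on_def o_def split_def power_mult_distrib)
  also have "\<dots> = (\<Sum>j\<in>rows. fiber D j ^ q) * (\<Sum>ys\<in>words rows k. rowprod (fiber D) ys ^ q)"
    by (simp add: sum_product sum.cartesian_product split_def)
  finally show ?case by (simp add: Suc)
qed simp

text \<open>The summand is the \<open>q\<close>-th power of the mass of the cell \<open>z\<close>;
  the first \<open>l\<close> letters are free and contribute only the factor
  \<open>card D ^ l\<close>.\<close>

lemma sum_cells_power:
  assumes "l \<le> k"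
  shows "(\<Sum>z\<in>key l ` words D k. rowprod (fiber D) (snd z) ^ q) =
    card D ^ l * (\<Sum>j\<in>rows. fiber D j ^ q) ^ (k - l)"
proof -
  have "(\<Sum>z\<in>words D l \<times> words rows (k - l). rowprod (fiber D) (snd z) ^ q) =
      (\<Sum>x\<in>words D l. \<Sum>y\<in>words rows (k - l). rowprod (fiber D) y ^ q)"
    by (simp only: sum.cartesian_product split_def)
  thus ?thesis
    unfolding key_image[OF assms] using finite_D by (simp add: sum_rowprod_power card_words)
qed

end

section \<open>Mass transfer between two digit sets\<close>

text \<open>What is kept of a bi-Lipschitz map: \<open>rel w v\<close> will mean that some point of
  the cylinder of \<open>w\<close> is mapped into the cylinder of \<open>v\<close>. The bound
  \<beta> does not depend on the level \<open>k\<close>, and \<open>rel_take\<close> ties the levels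
  together. The axioms are symmetric in \<open>D\<close> and \<open>D'\<close>, so an inequality
  shown in one direction holds in both.\<close>

locale coarse_equiv = E: digit_set n m D + F: digit_set n m D'
  for n m :: nat and D D' :: "(nat \<times> nat) set" +
  fixes rel :: "(nat \<times> nat) list \<Rightarrow> (nat \<times> nat) list \<Rightarrow> bool" and \<beta> :: "nat \<Rightarrow> nat"
  assumes left_total: "w \<in> words D k \<Longrightarrow> \<exists>v\<in>words D' k. rel w v"
    and right_total: "v \<in> words D' k \<Longrightarrow> \<exists>w\<in>words D k. rel w v"
    and near_forward: "\<lbrakk>w \<in> words D k; w1 \<in> words D k; v \<in> words D' k; v1 \<in> words D' k; rel w v; rel w1 v1;
      near n m B w w1\<rbrakk> \<Longrightarrow> near n m (\<beta> B) v v1"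
    and near_backward: "\<lbrakk>w \<in> words D k; w1 \<in> words D k; v \<in> words D' k; v1 \<in> words D' k; rel w v; rel w1 v1;
      near n m B v v1\<rbrakk> \<Longrightarrow> near n m (\<beta> B) w w1"
    and rel_take: "\<lbrakk>w \<in> words D K; v \<in> words D' K; rel w v; k \<le> K\<rbrakk> \<Longrightarrow> rel (take k w) (take k v)"
begin

lemma swapped: "coarse_equiv n m D' D (\<lambda>v w. rel w v) \<beta>"
  using left_total right_total near_forward near_backward rel_take
  by unfold_locales blast+

text \<open>\<phi> hits each cell with bounded multiplicity: if \<open>\<phi> w\<close> and
  \<open>\<phi> w0\<close> share a cell, their related words are \<open>2 * B\<close>-near, hence
  \<open>w\<close> and \<open>w0\<close> are \<open>\<beta> (2 * B)\<close>-near, and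
  \<open>card_near_keys\<close> bounds the number of such cells. \<open>S\<close> has at most one
  word in each.\<close>

lemma transport:
  fixes g :: "(nat \<times> nat) list \<times> nat list \<Rightarrow> nat"
  assumes S: "S \<subseteq> words D k" "inj_on (key (ell n m k)) S"
    and \<phi>: "\<And>w. w \<in> S \<Longrightarrow> \<phi> w \<in> words D' k"
      "\<And>w. w \<in> S \<Longrightarrow> \<exists>v\<in>words D' k. rel w v \<and> near n m B (\<phi> w) v"
  shows "(\<Sum>w\<in>S. g (key (ell n m k) (\<phi> w)))
    \<le> (2 * \<beta> (2 * B) + 1) ^ 2 * (\<Sum>z\<in>key (ell n m k) ` \<phi> ` S. g z)"
proof -
  let ?h = "\<lambda>w. key (ell n m k) (\<phi> w)"
  have fin: "finite S" using S(1) finite_words[OF E.finite_D] finite_subset by blast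
  have fib: "card {w \<in> S. ?h w = z} \<le> (2 * \<beta> (2 * B) + 1) ^ 2" for z
  proof (cases "{w \<in> S. ?h w = z} = {}")
    case False
    then obtain w0 where w0: "w0 \<in> S" "?h w0 = z" by blast
    have "near n m (\<beta> (2 * B)) w w0" if "w \<in> {w \<in> S. ?h w = z}" for w
    proof -
      from that have w: "w \<in> S" "?h w = ?h w0" using w0 by auto
      obtain v v0 where v: "v \<in> words D' k" "rel w v" "near n m B (\<phi> w) v"
          "v0 \<in> words D' k" "rel w0 v0" "near n m B (\<phi> w0) v0"
        using \<phi>(2)[OF w(1)] \<phi>(2)[OF w0(1)] by blast
      have "near n m 0 (\<phi> w) (\<phi> w0)"
        using F.near_0_key[OF \<phi>(1)[OF w(1)] \<phi>(1)[OF w0(1)]] w(2) by simp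
      hence "near n m (B + (0 + B)) v v0"
        by (intro near_trans[OF near_sym[OF v(3)] near_trans[OF _ v(6)]])
      hence "near n m (2 * B) v v0" by (simp add: mult_2)
      thus ?thesis
        using near_backward[OF subsetD[OF S(1) w(1)] subsetD[OF S(1) w0(1)] v(1,4,2,5)] by simp
    qed
    moreover have "{w \<in> S. ?h w = z} \<subseteq> words D k" using S(1) by blast
    ultimately have "card (key (ell n m k) ` {w \<in> S. ?h w = z}) \<le> (2 * \<beta> (2 * B) + 1) ^ 2"
      by (intro E.card_near_keys(2))
    moreover have "inj_on (key (ell n m k)) {w \<in> S. ?h w = z}"
      using S(2) by (rule inj_on_subset) auto
    ultimately show ?thesis by (simp add: card_image)
  next
    case True
    show ?thesis unfolding True by simp
  qed
  have "(\<Sum>w\<in>S. g (?h w)) = (\<Sum>z\<in>?h ` S. \<Sum>w\<in>{w. w \<in> S \<and> ?h w = z}. g (?h w))"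
    by (rule sum.image_gen[OF fin])
  also have "\<dots> = (\<Sum>z\<in>?h ` S. card {w \<in> S. ?h w = z} * g z)"
    by (rule sum.cong) auto
  also have "\<dots> \<le> (\<Sum>z\<in>?h ` S. (2 * \<beta> (2 * B) + 1) ^ 2 * g z)"
    by (intro sum_mono mult_le_mono1 fib)
  finally show ?thesis by (simp add: sum_distrib_left image_image)
qed

text \<open>Choose one word per cell of \<open>T\<close> and one related word for each;
  \<open>transport\<close> with weight 1 bounds how often a cell is hit.\<close>

lemma card_image_cells_le:
  assumes "T \<subseteq> words D K" and "\<And>u v. u \<in> T \<Longrightarrow> v \<in> words D' K \<Longrightarrow> rel u v \<Longrightarrow> v \<in> T'"
  shows "card (key (ell n m K) ` T) \<le> (2 * \<beta> 0 + 1) ^ 2 * card (key (ell n m K) ` (T' \<inter> words D' K))"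
proof -
  let ?key = "key (ell n m K)"
  obtain S where S: "S \<subseteq> T" "inj_on ?key S" "?key ` T = ?key ` S"
    using subset_image_inj[of "?key ` T" ?key T] by auto
  define \<phi> where "\<phi> u = (SOME v. v \<in> words D' K \<and> rel u v)" for u
  have \<phi>: "\<phi> u \<in> words D' K" "rel u (\<phi> u)" if "u \<in> S" for u
    using someI_ex[of "\<lambda>v. v \<in> words D' K \<and> rel u v"] left_total[of u K] that S(1) assms(1)
    unfolding \<phi>_def by blast+
  have sub: "\<phi> ` S \<subseteq> T' \<inter> words D' K"
    using \<phi> S(1) assms(2) by blast
  have "(\<Sum>w\<in>S. 1) \<le> (2 * \<beta> (2 * 0) + 1) ^ 2 * (\<Sum>z\<in>?key ` \<phi> ` S. (1::nat))"
  proof (rule transport[where g = "\<lambda>_. 1" and B = 0])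
    show "S \<subseteq> words D K" using S(1) assms(1) by blast
    show "\<exists>v\<in>words D' K. rel w v \<and> near n m 0 (\<phi> w) v" if "w \<in> S" for w
      using \<phi>[OF that] by (intro bexI[of _ "\<phi> w"]) simp_all
  qed (use S(2) \<phi>(1) in simp_all)
  hence "card S \<le> (2 * \<beta> 0 + 1) ^ 2 * card (?key ` \<phi> ` S)" by simp
  also have "card (?key ` \<phi> ` S) \<le> card (?key ` (T' \<inter> words D' K))"
    using finite_words[OF F.finite_D] sub by (intro card_mono finite_imageI image_mono) auto
  finally show ?thesis using S by (simp add: card_image)
qed

lemma total_cells_le:
  assumes "l = ell n m K"
  shows "card D ^ l * card E.rows ^ (K - l) \<le>
    (2 * \<beta> 0 + 1) ^ 2 * (card D' ^ l * card F.rows ^ (K - l))"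
proof -
  have "l \<le> K" unfolding assms by (rule E.lev_le)
  show ?thesis
    using card_image_cells_le[of "words D K" K UNIV]
      E.card_all_cells[OF \<open>l \<le> K\<close>] F.card_all_cells[OF \<open>l \<le> K\<close>] assms by simp
qed

text \<open>This compares the masses normalised by \<open>card D ^ k\<close> and
  \<open>card D' ^ k\<close>. The finer cells inside the cell of \<open>w\<close> have images in the
  at most \<open>M\<close> cells near \<open>v0\<close>, so the heaviest of these, \<open>v\<close>,
  holds a fixed proportion. The three factors \<open>M\<close> come from the multiplicity of images,
  the number of near cells and \<open>total_cells_le\<close>.\<close>

lemma mass_transfer:
  assumes w: "w \<in> words D k" and v0: "v0 \<in> words D' k" "rel w v0"
  shows "\<exists>v\<in>words D' k. near n m (\<beta> 0) v v0 \<and>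
    E.mass (ell n m k) w * card D' ^ k
      \<le> (2 * \<beta> 0 + 1) ^ 6 * F.mass (ell n m k) v * card D ^ k"
proof -
  define l where "l = ell n m k"
  \<comment> \<open>At such a level the finer cells fix all of the first \<open>k\<close> letters,
    so their number sees the columns that the cell of \<open>w\<close> leaves open.\<close>
  obtain K where "k \<le> ell n m K" using ell_unbounded[OF E.m_ge E.m_less] by blast
  define l' where "l' = ell n m K"
  define M where "M = (2 * \<beta> 0 + 1) ^ 2"
  have le: "l \<le> k" "k \<le> l'" "l' \<le> K"
    using \<open>k \<le> ell n m K\<close> E.lev_le by (auto simp: l_def l'_def)
  let ?Near = "{v \<in> words D' k. near n m (\<beta> 0) v v0}"
  obtain R where R: "R \<subseteq> ?Near" "inj_on (key l) R" "key l ` ?Near = key l ` R"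
    using subset_image_inj[of "key l ` ?Near" "key l" ?Near] by auto
  have "card R = card (key l ` ?Near)" using R by (simp add: card_image)
  also have "\<dots> \<le> M" unfolding M_def l_def by (rule F.card_near_keys(2)) auto
  finally have cardR: "card R \<le> M" .
  have "finite ?Near" using finite_words[OF F.finite_D] by simp
  hence finR: "finite R" using R(1) by (rule rev_finite_subset)
  have "v0 \<in> ?Near" using v0 by simp
  hence "R \<noteq> {}" using R(3) by blast
  define mx where "mx = Max (F.mass l ` R)"
  have mx: "F.mass l v \<le> mx" if "v \<in> R" for v using that finR by (auto simp: mx_def)
  have "mx \<in> F.mass l ` R" unfolding mx_def using finR \<open>R \<noteq> {}\<close> by (intro Max_in) auto
  then obtain v where v: "v \<in> R" "mx = F.mass l v" by auto
  define T where "T = {u \<in> words D K. key l (take k u) = key l w}"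
  define Q where "Q v = {u \<in> words D' K. key l (take k u) = key l v}" for v
  have T: "card (key l' ` T) = E.mass l w * card D ^ (l' - k) * card E.rows ^ (K - l')"
    unfolding T_def by (rule E.card_subcells[OF w le])
  have "card (key l' ` T) \<le> M * card (key l' ` ((\<Union>v\<in>R. Q v) \<inter> words D' K))"
    unfolding M_def l'_def
  proof (rule card_image_cells_le)
    show "T \<subseteq> words D K" by (auto simp: T_def)
    fix u v assume u: "u \<in> T" "v \<in> words D' K" "rel u v"
    have kK: "k \<le> K" using le by simp
    have tk: "take k u \<in> words D k" "take k v \<in> words D' k" "rel (take k u) (take k v)"
      using u kK words_take rel_take by (auto simp: T_def)
    have "near n m 0 (take k u) w"
      using E.near_0_key[OF tk(1) w] u by (simp add: T_def l_def)
    hence "take k v \<in> ?Near" using near_forward[OF tk(1) w tk(2) v0(1) tk(3) v0(2)] tk by simp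
    hence "key l (take k v) \<in> key l ` R" using R(3) by blast
    thus "v \<in> (\<Union>v\<in>R. Q v)" using u by (auto simp: Q_def)
  qed
  also have "(\<Union>v\<in>R. Q v) \<inter> words D' K = (\<Union>v\<in>R. Q v)" by (auto simp: Q_def)
  also have "card (key l' ` (\<Union>v\<in>R. Q v)) \<le> (\<Sum>v\<in>R. card (key l' ` Q v))"
    unfolding image_UN by (rule card_UN_le[OF finR])
  also have "\<dots> = (\<Sum>v\<in>R. F.mass l v * card D' ^ (l' - k) * card F.rows ^ (K - l'))"
  proof (rule sum.cong)
    fix v assume "v \<in> R"
    hence "v \<in> words D' k" using R(1) by auto
    thus "card (key l' ` Q v) = F.mass l v * card D' ^ (l' - k) * card F.rows ^ (K - l')"
      unfolding Q_def by (rule F.card_subcells[OF _ le])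
  qed simp
  also have "\<dots> \<le> (\<Sum>v\<in>R. mx * card D' ^ (l' - k) * card F.rows ^ (K - l'))"
    by (intro sum_mono mult_le_mono mx le_refl)
  also have "\<dots> = card R * (mx * card D' ^ (l' - k) * card F.rows ^ (K - l'))" by simp
  also have "\<dots> \<le> M * (mx * card D' ^ (l' - k) * card F.rows ^ (K - l'))"
    by (intro mult_le_mono cardR le_refl)
  finally have 1: "E.mass l w * card D ^ (l' - k) * card E.rows ^ (K - l') \<le>
      M * (M * (mx * card D' ^ (l' - k) * card F.rows ^ (K - l')))"
    unfolding T by simp
  interpret sw: coarse_equiv n m D' D "\<lambda>v w. rel w v" \<beta> by (rule swapped)
  \<comment> \<open>The total counts are compared in the opposite direction, from \<open>D'\<close>
    to \<open>D\<close>. This trades the fine-level factors of \<open>D'\<close>, including its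
    unknown number of rows, for those of \<open>D\<close>, after which \<open>c\<close>
    cancels.\<close>
  have 2: "card D' ^ l' * card F.rows ^ (K - l') \<le> M * (card D ^ l' * card E.rows ^ (K - l'))"
    unfolding M_def by (rule sw.total_cells_le) (simp add: l'_def)
  define c where "c = card D ^ (l' - k) * card E.rows ^ (K - l')"
  have "c > 0" unfolding c_def using E.card_D_pos E.finite_D E.D_nonempty by (simp add: card_gt_0_iff)
  have p: "card A ^ l' = card A ^ (l' - k) * card A ^ k" for A :: "(nat \<times> nat) set"
    using le by (simp add: power_add[symmetric])
  have "(E.mass l w * card D' ^ k) * c \<le>
      (M * (M * (mx * card D' ^ (l' - k) * card F.rows ^ (K - l')))) * card D' ^ k"
    using mult_le_mono1[OF 1, of "card D' ^ k"] by (simp add: c_def algebra_simps)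
  also have "\<dots> = M * M * mx * (card D' ^ l' * card F.rows ^ (K - l'))"
    by (simp add: p algebra_simps)
  also have "\<dots> \<le> M * M * mx * (M * (card D ^ l' * card E.rows ^ (K - l')))"
    by (intro mult_le_mono 2 le_refl)
  also have "\<dots> = (M ^ 3 * mx * card D ^ k) * c"
    by (simp add: p c_def algebra_simps power3_eq_cube)
  finally have "E.mass l w * card D' ^ k \<le> M ^ 3 * mx * card D ^ k"
    using \<open>c > 0\<close> by simp
  also have "M ^ 3 = (2 * \<beta> 0 + 1) ^ 6" by (simp add: M_def flip: power_mult)
  finally show ?thesis using v R(1) by (auto simp: l_def)
qed

text \<open>The sum of the \<open>q\<close>-th powers of the masses is compared over all cells of
  level \<open>k\<close>. Each cell is sent to a cell of \<open>D'\<close> at least as heavy up to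
  the factor \<open>C\<close>, and \<open>transport\<close> bounds the repetitions. As the
  cardinalities agree, the normalisations and the factors \<open>card D ^ l\<close> cancel.\<close>

lemma power_sum_le:
  fixes q :: nat
  assumes "card D = card D'"
  shows "\<exists>C>0. \<forall>k. (\<Sum>j\<in>E.rows. fiber D j ^ q) ^ (k - ell n m k)
      \<le> C * (\<Sum>j\<in>F.rows. fiber D' j ^ q) ^ (k - ell n m k)"
proof -
  define C where "C = (2 * \<beta> 0 + 1) ^ 6"
  define M where "M = (2 * \<beta> (2 * \<beta> 0) + 1) ^ 2"
  have "(\<Sum>j\<in>E.rows. fiber D j ^ q) ^ (k - ell n m k)
      \<le> C ^ q * M * (\<Sum>j\<in>F.rows. fiber D' j ^ q) ^ (k - ell n m k)" for k
  proof -
    define l where "l = ell n m k"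
    have "l \<le> k" unfolding l_def by (rule E.lev_le)
    obtain S where S: "S \<subseteq> words D k" "inj_on (key l) S" "key l ` words D k = key l ` S"
      using subset_image_inj[of "key l ` words D k" "key l" "words D k"] by auto
    have "\<exists>v. v \<in> words D' k \<and> (\<exists>v0\<in>words D' k. rel w v0 \<and> near n m (\<beta> 0) v v0) \<and>
        E.mass l w \<le> C * F.mass l v" if "w \<in> S" for w
    proof -
      have w: "w \<in> words D k" using that S by auto
      obtain v0 where v0: "v0 \<in> words D' k" "rel w v0" using left_total[OF w] by blast
      obtain v where v: "v \<in> words D' k" "near n m (\<beta> 0) v v0"
          "E.mass l w * card D' ^ k \<le> C * F.mass l v * card D ^ k"
        using mass_transfer[OF w v0] unfolding C_def l_def by blast
      have "E.mass l w \<le> C * F.mass l v" using v(3) E.card_D_pos by (simp add: assms)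
      thus ?thesis using v v0 by blast
    qed
    then obtain \<phi> where \<phi>: "\<And>w. w \<in> S \<Longrightarrow> \<phi> w \<in> words D' k"
      "\<And>w. w \<in> S \<Longrightarrow> \<exists>v0\<in>words D' k. rel w v0 \<and> near n m (\<beta> 0) (\<phi> w) v0"
      "\<And>w. w \<in> S \<Longrightarrow> E.mass l w \<le> C * F.mass l (\<phi> w)"
      by metis
    have "card D ^ l * (\<Sum>j\<in>E.rows. fiber D j ^ q) ^ (k - l)
        = (\<Sum>z\<in>key l ` S. rowprod (fiber D) (snd z) ^ q)"
      using E.sum_cells_power[OF \<open>l \<le> k\<close>] S by simp
    also have "\<dots> = (\<Sum>w\<in>S. E.mass l w ^ q)"
      unfolding sum.reindex[OF S(2)] by (simp add: E.mass_def key_def)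
    also have "\<dots> \<le> (\<Sum>w\<in>S. (C * F.mass l (\<phi> w)) ^ q)"
      by (intro sum_mono power_mono \<phi>(3)) auto
    also have "\<dots> = C ^ q * (\<Sum>w\<in>S. rowprod (fiber D') (snd (key l (\<phi> w))) ^ q)"
      by (simp add: power_mult_distrib sum_distrib_left F.mass_def key_def)
    also have "(\<Sum>w\<in>S. rowprod (fiber D') (snd (key l (\<phi> w))) ^ q)
        \<le> M * (\<Sum>z\<in>key l ` \<phi> ` S. rowprod (fiber D') (snd z) ^ q)"
      unfolding M_def l_def
      by (rule transport[where B = "\<beta> 0" and g = "\<lambda>z. rowprod (fiber D') (snd z) ^ q"])
        (use S \<phi> in \<open>auto simp: l_def\<close>)
    also have "(\<Sum>z\<in>key l ` \<phi> ` S. rowprod (fiber D') (snd z) ^ q)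
        \<le> (\<Sum>z\<in>key l ` words D' k. rowprod (fiber D') (snd z) ^ q)"
      using finite_words[OF F.finite_D] \<phi>(1) by (intro sum_mono2) auto
    also have "\<dots> = card D' ^ l * (\<Sum>j\<in>F.rows. fiber D' j ^ q) ^ (k - l)"
      by (rule F.sum_cells_power[OF \<open>l \<le> k\<close>])
    finally have "card D ^ l * (\<Sum>j\<in>E.rows. fiber D j ^ q) ^ (k - l) \<le>
        card D ^ l * (C ^ q * M * (\<Sum>j\<in>F.rows. fiber D' j ^ q) ^ (k - l))"
      by (simp add: assms algebra_simps)
    thus ?thesis using E.card_D_pos by (simp add: l_def)
  qed
  moreover have "C ^ q * M > 0" by (simp add: C_def M_def)
  ultimately show ?thesis by blast
qed

end

section \<open>Extremal neighbouring cells\<close>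

text \<open>Otherwise \<open>(x / y) ^ f k\<close> would be unbounded. This is how comparisons up to
  a constant become exact ones.\<close>

lemma power_growth_le:
  fixes x y C :: real
  assumes "filterlim f at_top F" "F \<noteq> bot" "0 < y" "\<forall>\<^sub>F k in F. x ^ f k \<le> C * y ^ f k"
  shows "x \<le> y"
proof (rule ccontr)
  assume "\<not> x \<le> y"
  hence gt: "1 < x / y" using assms(3) by simp
  obtain i where i: "C < (x / y) ^ i" using real_arch_pow[OF gt] by blast
  have "\<forall>\<^sub>F k in F. i \<le> f k" using assms(1) by (simp add: filterlim_at_top)
  with assms(4) have "\<forall>\<^sub>F k in F. False"
  proof eventually_elim
    case (elim k)
    have "(x / y) ^ i \<le> (x / y) ^ f k" using elim gt by (intro power_increasing) auto
    also have "\<dots> \<le> C" using elim assms(3) by (simp add: power_divide divide_le_eq)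
    finally show ?case using i by simp
  qed
  thus False using assms(2) by simp
qed

lemma digval_replicate_0: "digval b (replicate q 0) = 0"
  by (induction q) (simp_all add: digval_Cons)

lemma digval_replicate_top: "0 < b \<Longrightarrow> Suc (digval b (replicate q (b - 1))) = b ^ q"
proof (induction q)
  case (Suc q)
  have "Suc (digval b (replicate (Suc q) (b - 1))) = (b - 1) * b ^ q + b ^ q"
    using Suc by (simp add: digval_Cons)
  also have "\<dots> = b ^ Suc q" using Suc.prems by (cases b) auto
  finally show ?case .
qed simp

text \<open>The offset \<open>low\<close> is at least \<open>P - 1\<close> and at most
  \<open>M - P\<close>, so a shift by at most \<open>B < P\<close> stays in the same block of length
  \<open>M\<close>.\<close>

lemma div_eq_of_near:
  fixes y q M low B P :: nat
  assumes "\<bar>int y - int (q * M + low)\<bar> \<le> int B" "B < P" "P \<le> Suc low" "low + P \<le> M"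
  shows "y div M = q"
proof -
  have "B \<le> low" using assms by simp
  hence "q * M \<le> y" "y < q * M + M" using assms by linarith+
  then obtain r where "y = q * M + r" "r < M" by (metis add_less_cancel_left le_Suc_ex)
  thus ?thesis by simp
qed

text \<open>The arithmetic criterion for non-doubling: carries occur (\<open>adjacent\<close>), and
  they exchange two occupied end rows of different size. \<open>carry_of_non_doubling\<close>
  derives it from the measure.\<close>

locale carry_digit_set = digit_set +
  assumes bottom_pos: "0 < fiber D 0" and top_pos: "0 < fiber D (m - 1)"
    and ends_neq: "fiber D 0 \<noteq> fiber D (m - 1)"
    and adjacent: "\<exists>j. Suc j < m \<and> 0 < fiber D j \<and> 0 < fiber D (Suc j)"
begin

text \<open>Maximum and minimum hide whether the heavier end row is the bottom or the top one, which
  may differ between the two carpets.\<close>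

definition hi :: nat where "hi = max (fiber D 0) (fiber D (m - 1))"
definition lo :: nat where "lo = min (fiber D 0) (fiber D (m - 1))"

lemma lo_pos: "0 < lo" using bottom_pos top_pos by (simp add: lo_def)
lemma lo_less_hi: "lo < hi" using ends_neq by (auto simp: lo_def hi_def)

lemma hi_le: "hi \<le> n" using fiber_le by (simp add: hi_def)

definition pick :: "nat \<Rightarrow> nat \<times> nat" where "pick j = (SOME d. d \<in> D \<and> snd d = j)"

lemma pick: "j \<in> rows \<Longrightarrow> pick j \<in> D \<and> snd (pick j) = j"
  unfolding pick_def by (rule someI_ex) auto

lemma pick_word:
  assumes "ys \<in> words rows k"
  shows "map pick ys \<in> words D k" "map snd (map pick ys) = ys"
proof -
  have *: "pick y \<in> D \<and> snd (pick y) = y" if "y \<in> set ys" for y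
    using assms that by (intro pick) (auto simp: words_def)
  thus "map pick ys \<in> words D k" using assms by (auto simp: words_def simp del: split_paired_All)
  have "map (snd \<circ> pick) ys = map id ys"
    using * by (intro map_cong) simp_all
  thus "map snd (map pick ys) = ys" by simp
qed

text \<open>\<open>b\<close> is the heavier and \<open>b'\<close> the lighter end digit, and
  \<open>c\<close>, \<open>c'\<close> are adjacent rows such that c b...b and c' b'...b' have
  consecutive values. Turning the last \<open>t\<close> digits of the second word into
  \<open>b\<close> moves it to distance \<open>m ^ t\<close>; its ending b' b...b then stays away
  from both ends of its block of \<open>m ^ Suc t\<close> values.\<close>

lemma carry_digits:
  obtains b b' c c' where "b \<in> rows" "b' \<in> rows" "c \<in> rows" "c' \<in> rows"
    "fiber D b = hi" "fiber D b' = lo"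
    "\<forall>r t. \<bar>int (digval m (c # replicate (r + t) b)) -
        int (digval m (c' # replicate r b' @ replicate t b))\<bar> \<le> int (m ^ t)"
    "\<forall>t. m ^ t \<le> Suc (digval m (b' # replicate t b)) \<and>
        digval m (b' # replicate t b) + m ^ t \<le> m ^ Suc t"
proof -
  obtain j where j: "Suc j < m" "0 < fiber D j" "0 < fiber D (Suc j)" using adjacent by blast
  have rows: "0 \<in> rows" "m - 1 \<in> rows" "j \<in> rows" "Suc j \<in> rows"
    using j bottom_pos top_pos by (simp_all add: fiber_pos)
  have top: "int (digval m (replicate q (m - 1))) = int m ^ q - 1" for q
    using digval_replicate_top[of m q] m_ge by (metis of_nat_Suc of_nat_power add_diff_cancel_left'
        of_nat_0_less_iff not_less zero_less_numeral less_le_trans)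
  show thesis
  proof (cases "fiber D (m - 1) < fiber D 0")
    case True
    show thesis
    proof (rule that[of 0 "m - 1" "Suc j" j])
      show "fiber D 0 = hi" "fiber D (m - 1) = lo" using True by (auto simp: hi_def lo_def)
      have eq: "int (digval m (j # replicate r (m - 1) @ replicate t 0)) + int (m ^ t) =
          int (digval m (Suc j # replicate (r + t) 0))" for r t
        by (simp add: digval_Cons digval_append digval_replicate_0 top[unfolded One_nat_def]
            power_add algebra_simps)
      show "\<forall>r t. \<bar>int (digval m (Suc j # replicate (r + t) 0)) -
          int (digval m (j # replicate r (m - 1) @ replicate t 0))\<bar> \<le> int (m ^ t)"
      proof (intro allI)
        fix r t show "\<bar>int (digval m (Suc j # replicate (r + t) 0)) -
            int (digval m (j # replicate r (m - 1) @ replicate t 0))\<bar> \<le> int (m ^ t)" using eq[of r t] by linarith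
      qed
      show "\<forall>t. m ^ t \<le> Suc (digval m ((m - 1) # replicate t 0)) \<and>
          digval m ((m - 1) # replicate t 0) + m ^ t \<le> m ^ Suc t"
        using m_ge by (cases m) (auto simp: digval_Cons digval_replicate_0 le_SucI)
    qed (fact rows)+
  next
    case False
    show thesis
    proof (rule that[of "m - 1" 0 j "Suc j"])
      show "fiber D (m - 1) = hi" "fiber D 0 = lo"
        using False ends_neq by (auto simp: hi_def lo_def)
      have eq: "int (digval m (Suc j # replicate r 0 @ replicate t (m - 1))) =
          int (digval m (j # replicate (r + t) (m - 1))) + int (m ^ t)" for r t
        by (simp add: digval_Cons digval_append digval_replicate_0 top[unfolded One_nat_def]
            power_add algebra_simps)
      show "\<forall>r t. \<bar>int (digval m (j # replicate (r + t) (m - 1))) -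
          int (digval m (Suc j # replicate r 0 @ replicate t (m - 1)))\<bar> \<le> int (m ^ t)"
      proof (intro allI)
        fix r t show "\<bar>int (digval m (j # replicate (r + t) (m - 1))) -
            int (digval m (Suc j # replicate r 0 @ replicate t (m - 1)))\<bar> \<le> int (m ^ t)" using eq[of r t] by linarith
      qed
      have "Suc (digval m (0 # replicate t (m - 1))) = m ^ t" for t
        using digval_replicate_top[of m t] m_ge by (simp add: digval_Cons)
      moreover have "2 * m ^ t \<le> m * m ^ t" for t using m_ge by (intro mult_le_mono1)
      ultimately have "m ^ t \<le> Suc (digval m (0 # replicate t (m - 1))) \<and>
          digval m (0 # replicate t (m - 1)) + m ^ t \<le> m ^ Suc t" for t
        by (smt (verit) Suc_leD add_le_mono le_refl le_trans mult_2 power_Suc)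
      thus "\<forall>t. m ^ t \<le> Suc (digval m (0 # replicate t (m - 1))) \<and>
          digval m (0 # replicate t (m - 1)) + m ^ t \<le> m ^ Suc t" by blast
    qed (fact rows)+
  qed
qed

text \<open>The last \<open>t + 1\<close> rows of the light word keep it away from the heavy cell, so that all cells
  within \<open>B\<close> of it are light.\<close>

lemma extremal_pair:
  assumes p: "p \<in> words D (lev k)" and large: "Suc t < k - lev k"
  shows "\<exists>w u. w \<in> words D k \<and> u \<in> words D k \<and> take (lev k) w = p \<and> near n m (m ^ t) w u \<and>
    hi ^ (k - lev k) \<le> n * mass (lev k) w \<and> mass (lev k) u \<le> n ^ Suc t * lo ^ (k - lev k) \<and>
    (\<forall>B x. B < m ^ t \<longrightarrow> x \<in> words D k \<longrightarrow> near n m B x u \<longrightarrow>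
       mass (lev k) x \<le> n ^ Suc t * mass (lev k) u)"
proof -
  obtain b b' c c' where digits: "b \<in> rows" "b' \<in> rows" "c \<in> rows" "c' \<in> rows"
    and fb: "fiber D b = hi" "fiber D b' = lo"
    and close: "\<forall>r t. \<bar>int (digval m (c # replicate (r + t) b)) -
        int (digval m (c' # replicate r b' @ replicate t b))\<bar> \<le> int (m ^ t)"
    and isolated: "\<forall>t. m ^ t \<le> Suc (digval m (b' # replicate t b)) \<and>
        digval m (b' # replicate t b) + m ^ t \<le> m ^ Suc t"
    by (rule carry_digits)
  define l where "l = lev k"
  \<comment> \<open>Beyond \<open>l\<close> there are one digit \<open>c\<close> or
    \<open>c'\<close> and \<open>Suc r + t\<close> end digits. The \<open>Suc\<close> leaves at
    least one \<open>b'\<close> before the final \<open>t\<close> digits, as \<open>isolated\<close>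
    requires; this is why \<open>large\<close> has \<open>Suc t\<close>.\<close>
  define r where "r = k - l - Suc (Suc t)"
  have L: "k - l = Suc (Suc r + t)" "l + Suc (Suc r + t) = k" and lenp: "length p = l"
    using large p by (auto simp: r_def l_def words_def)
  define ys where "ys = c # replicate (Suc r + t) b"
  define zs where "zs = c' # replicate (Suc r) b' @ replicate t b"
  have ys: "ys \<in> words rows (k - l)" and zs: "zs \<in> words rows (k - l)"
    using digits by (simp_all add: words_def ys_def zs_def L set_replicate_conv_if)
  define w where "w = p @ map pick ys"
  define u where "u = p @ map pick zs"
  have pl: "p \<in> words D l" using p by (simp add: l_def)
  have w: "w \<in> words D k" and u: "u \<in> words D k"
    using words_append[OF pl pick_word(1)[OF ys]] words_append[OF pl pick_word(1)[OF zs]] L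
    by (simp_all add: w_def u_def)
  have snds: "map snd w = map snd p @ ys" "map snd u = map snd p @ zs"
    using pick_word(2)[OF ys] pick_word(2)[OF zs] by (simp_all add: w_def u_def)
  have takes: "take l w = p" "take l u = p" by (simp_all add: w_def u_def lenp)
  have masses: "mass l w = rowprod (fiber D) ys" "mass l u = rowprod (fiber D) zs"
    unfolding mass_def snds by (simp_all add: lenp)
  have len: "length w = k" "length u = k" using w u by (auto simp: words_def)
  have len2: "length ys = length zs" using ys zs by (simp add: words_def)
  have "near n m (m ^ t) w u"
    unfolding near_def len l_def[symmetric] takes snds digval_append len2
    using close[rule_format, of "Suc r" t] by (simp add: ys_def zs_def)
  moreover have "hi ^ (k - l) \<le> n * mass l w"
  proof -
    have "1 \<le> fiber D c" using digits(3) fiber_pos by (simp add: Suc_leI)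
    hence "hi * 1 * hi ^ (Suc r + t) \<le> n * fiber D c * hi ^ (Suc r + t)"
      by (intro mult_le_mono hi_le le_refl)
    thus ?thesis by (simp add: masses ys_def fb L)
  qed
  moreover have "mass l u \<le> n ^ Suc t * lo ^ (k - l)"
  proof -
    have "mass l u = fiber D c' * hi ^ t * lo ^ Suc r" by (simp add: masses zs_def fb)
    also have "\<dots> \<le> n * n ^ t * lo ^ (k - l)"
      using hi_le fiber_le lo_pos L by (intro mult_le_mono power_mono power_increasing) auto
    finally show ?thesis by simp
  qed
  moreover have "mass l x \<le> n ^ Suc t * mass l u" if "B < m ^ t" "x \<in> words D k" "near n m B x u" for B x
  proof -
    \<comment> \<open>The row word of \<open>u\<close> without its last \<open>t + 1\<close> digits.
      By \<open>isolated\<close> every cell within \<open>B\<close> shares it, so only those digits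
      can change the mass.\<close>
    define q where "q = map snd p @ c' # replicate r b'"
    have snd_u: "map snd u = q @ b' # replicate t b"
      by (simp add: snds q_def zs_def replicate_append_same)
    have "\<bar>int (digval m (map snd x)) - int (digval m (map snd u))\<bar> \<le> int B"
      using that(3) by (simp add: near_def)
    hence "digval m (map snd x) div m ^ Suc t = digval m q"
      unfolding snd_u digval_append[of _ q] using isolated[rule_format, of t] that(1)
      by (intro div_eq_of_near[where low = "digval m (b' # replicate t b)" and P = "m ^ t" and B = B]) auto
    moreover have lx: "length (map snd x) = k" "length q = k - Suc t"
      using that(2) L by (auto simp: words_def q_def lenp)
    ultimately have "digval m (take (k - Suc t) (map snd x)) = digval m q"
      using digval_take[OF snd_digits[OF that(2)], of "Suc t"] by simp
    moreover have "set (take (k - Suc t) (map snd x)) \<subseteq> {..<m}" "set q \<subseteq> {..<m}"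
      using snd_digits[OF that(2)] set_take_subset[of "k - Suc t" "map snd x"] snd_digits[OF u]
      by (auto simp: snd_u)
    ultimately have "take (k - Suc t) (map snd x) = q"
      using lx by (intro digval_inj[of _ _ m]) auto
    hence split: "map snd x = q @ drop (k - Suc t) (map snd x)"
      by (metis append_take_drop_id)
    show ?thesis
      unfolding mass_def
    proof (rule common_prefix_rows[OF split snd_u])
      show "\<forall>y\<in>set (map snd x) \<union> set (map snd u). 0 < fiber D y \<and> fiber D y \<le> n"
        using words_row_fiber[OF snd_word[OF that(2)]] words_row_fiber[OF snd_word[OF u]] by blast
      show "0 < n" by (rule n_pos)
      show "length (drop (k - Suc t) (map snd x)) \<le> Suc t" using lx L by simp
    qed
  qed
  ultimately show ?thesis using w u takes unfolding l_def by blast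
qed

end

section \<open>Invariants\<close>

locale carry_equiv = E: carry_digit_set n m D + F: carry_digit_set n m D' +
  coarse_equiv n m D D' rel \<beta>
  for n m :: nat and D D' :: "(nat \<times> nat) set"
    and rel :: "(nat \<times> nat) list \<Rightarrow> (nat \<times> nat) list \<Rightarrow> bool" and \<beta> :: "nat \<Rightarrow> nat"
begin

lemma swapped_carry: "carry_equiv n m D' D (\<lambda>v w. rel w v) \<beta>"
  by (rule carry_equiv.intro) (rule F.carry_digit_set_axioms E.carry_digit_set_axioms swapped)+

text \<open>\<open>w\<close> is heavy, so its transfer \<open>v\<close> is heavy. The light partner
  \<open>u\<close> is related to \<open>v'\<close>, whose mass is bounded by transferring
  \<open>v'\<close> back to some \<open>x\<close> near \<open>u\<close>; such an \<open>x\<close> is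
  light by the construction of \<open>u\<close>. In the product of both bounds the powers of
  \<open>card D\<close> and \<open>card D'\<close> cancel.\<close>

lemma extremal_image:
  obtains C B t where "\<And>k p. Suc t < k - ell n m k \<Longrightarrow> p \<in> words D (ell n m k) \<Longrightarrow>
    \<exists>w\<in>words D k. \<exists>v0\<in>words D' k. \<exists>v\<in>words D' k. \<exists>v'\<in>words D' k.
      take (ell n m k) w = p \<and> rel w v0 \<and> near n m (\<beta> 0) v v0 \<and> near n m B v v' \<and>
      E.hi ^ (k - ell n m k) * card D' ^ k \<le> C * card D ^ k * F.mass (ell n m k) v \<and>
      E.hi ^ (k - ell n m k) * F.mass (ell n m k) v'
        \<le> C * E.lo ^ (k - ell n m k) * F.mass (ell n m k) v"
proof -
  interpret sw: coarse_equiv n m D' D "\<lambda>v w. rel w v" \<beta> by (rule swapped)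
  \<comment> \<open>The back transfer lands up to \<open>\<beta> 0\<close> steps from
    \<open>u\<close>, so the light neighbourhood needs a radius above \<open>\<beta> 0\<close>; this
    choice works because \<open>\<beta> 0 < m ^ \<beta> 0\<close>.\<close>
  define t where "t = \<beta> 0"
  have t: "\<beta> 0 < m ^ t" unfolding t_def using E.m_ge
    by (meson less_exp order_less_le_trans power_mono zero_le)
  define C0 where "C0 = (2 * \<beta> 0 + 1) ^ 6"
  define C1 where "C1 = n ^ Suc t * n ^ Suc t * C0"
  \<comment> \<open>The first term is the step from \<open>v\<close> to \<open>v0\<close>, the
    second the image of the step from \<open>w\<close> to \<open>u\<close>.\<close>
  define B where "B = \<beta> 0 + \<beta> (m ^ t)"
  have "1 \<le> n ^ Suc t * n ^ Suc t" using E.n_pos by (simp add: Suc_leI)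
  have C0: "1 \<le> C0" by (simp add: C0_def)
  have C1: "1 \<le> C1" unfolding C1_def using \<open>1 \<le> n ^ Suc t * n ^ Suc t\<close> C0
    by (metis mult_le_mono nat_mult_1)
  show thesis
  proof (rule that[of t B "n * C0 * C1"])
    fix k p assume large: "Suc t < k - ell n m k" and p: "p \<in> words D (ell n m k)"
    define l where "l = ell n m k"
    define L where "L = k - l"
    obtain w u where w: "w \<in> words D k" "take l w = p" "E.hi ^ L \<le> n * E.mass l w"
      and u: "u \<in> words D k" "near n m (m ^ t) w u" "E.mass l u \<le> n ^ Suc t * E.lo ^ L"
      and light: "\<And>x. x \<in> words D k \<Longrightarrow> near n m (\<beta> 0) x u \<Longrightarrow>
        E.mass l x \<le> n ^ Suc t * E.mass l u"
      using E.extremal_pair[OF p large] t unfolding l_def L_def by blast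
    obtain v0 v' where v0: "v0 \<in> words D' k" "rel w v0" and v': "v' \<in> words D' k" "rel u v'"
      using left_total w(1) u(1) by meson
    obtain v where v: "v \<in> words D' k" "near n m (\<beta> 0) v v0"
        "E.mass l w * card D' ^ k \<le> C0 * F.mass l v * card D ^ k"
      using mass_transfer[OF w(1) v0] unfolding C0_def l_def by blast
    obtain x where x: "x \<in> words D k" "near n m (\<beta> 0) x u"
        "F.mass l v' * card D ^ k \<le> C0 * E.mass l x * card D' ^ k"
      using sw.mass_transfer[OF v'(1) u(1) v'(2)] unfolding C0_def l_def by blast
    have "near n m (\<beta> (m ^ t)) v0 v'"
      by (rule near_forward[OF w(1) u(1) v0(1) v'(1) v0(2) v'(2) u(2)])
    hence near: "near n m B v v'" unfolding B_def by (rule near_trans[OF v(2)])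
    have "E.hi ^ L * card D' ^ k \<le> n * E.mass l w * card D' ^ k"
      by (rule mult_le_mono1[OF w(3)])
    also have "\<dots> = n * (E.mass l w * card D' ^ k)" by simp
    also have "\<dots> \<le> n * (C0 * F.mass l v * card D ^ k)"
      by (rule mult_le_mono2[OF v(3)])
    finally have 1: "E.hi ^ L * card D' ^ k \<le> n * C0 * card D ^ k * F.mass l v"
      by (simp add: algebra_simps)
    have "F.mass l v' * card D ^ k \<le> C0 * E.mass l x * card D' ^ k" by (rule x(3))
    also have "\<dots> \<le> C0 * (n ^ Suc t * (n ^ Suc t * E.lo ^ L)) * card D' ^ k"
      using light[OF x(1,2)] u(3) by (intro mult_le_mono1 mult_le_mono2) (meson le_trans mult_le_mono2)
    finally have 2: "F.mass l v' * card D ^ k \<le> C1 * E.lo ^ L * card D' ^ k"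
      by (simp add: C1_def algebra_simps)
    have "(E.hi ^ L * F.mass l v') * (card D' ^ k * card D ^ k) =
        (E.hi ^ L * card D' ^ k) * (F.mass l v' * card D ^ k)" by (simp add: algebra_simps)
    also have "\<dots> \<le> (n * C0 * card D ^ k * F.mass l v) * (C1 * E.lo ^ L * card D' ^ k)"
      by (rule mult_le_mono[OF 1 2])
    also have "\<dots> = (n * C0 * C1 * E.lo ^ L * F.mass l v) * (card D' ^ k * card D ^ k)"
      by (simp add: algebra_simps)
    finally have 3: "E.hi ^ L * F.mass l v' \<le> n * C0 * C1 * E.lo ^ L * F.mass l v"
      using E.card_D_pos F.card_D_pos by simp
    note 1
    also have "n * C0 * card D ^ k * F.mass l v \<le> n * C0 * card D ^ k * F.mass l v * C1"
      using mult_le_mono2[OF C1, of "n * C0 * card D ^ k * F.mass l v"] by simp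
    also have "\<dots> = n * C0 * C1 * card D ^ k * F.mass l v" by (simp add: algebra_simps)
    finally have 4: "E.hi ^ L * card D' ^ k \<le> n * C0 * C1 * card D ^ k * F.mass l v" .
    show "\<exists>w\<in>words D k. \<exists>v0\<in>words D' k. \<exists>v\<in>words D' k. \<exists>v'\<in>words D' k.
      take (ell n m k) w = p \<and> rel w v0 \<and> near n m (\<beta> 0) v v0 \<and> near n m B v v' \<and>
      E.hi ^ (k - ell n m k) * card D' ^ k \<le> n * C0 * C1 * card D ^ k * F.mass (ell n m k) v \<and>
      E.hi ^ (k - ell n m k) * F.mass (ell n m k) v'
        \<le> n * C0 * C1 * E.lo ^ (k - ell n m k) * F.mass (ell n m k) v"
      using w v0 v v' near 3 4 unfolding l_def L_def by blast
  qed
qed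

text \<open>Only a carry run can make the neighbours \<open>v\<close> and \<open>v'\<close> so
  unequal: \<open>near_mass\<close> bounds their ratio by a constant times
  \<open>(F.hi / F.lo) ^ e\<close>, where \<open>e\<close> is the length of a run of one end digit
  in \<open>v\<close>.\<close>

lemma extremal_structure:
  obtains C t where "0 < C" "\<And>k p. Suc t < k - ell n m k \<Longrightarrow> p \<in> words D (ell n m k) \<Longrightarrow>
    \<exists>w\<in>words D k. \<exists>v0\<in>words D' k. \<exists>v\<in>words D' k. \<exists>b e s s'.
      take (ell n m k) w = p \<and> rel w v0 \<and> near n m (\<beta> 0) v v0 \<and>
      E.hi ^ (k - ell n m k) * card D' ^ k \<le> C * card D ^ k * F.mass (ell n m k) v \<and>
      b \<in> {0, m - 1} \<and> drop (ell n m k) (map snd v) = s @ replicate e b @ s' \<and>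
      E.hi ^ (k - ell n m k) * F.lo ^ e \<le> C * E.lo ^ (k - ell n m k) * F.hi ^ e"
proof -
  obtain C B t where ext: "\<And>k p. Suc t < k - ell n m k \<Longrightarrow> p \<in> words D (ell n m k) \<Longrightarrow>
    \<exists>w\<in>words D k. \<exists>v0\<in>words D' k. \<exists>v\<in>words D' k. \<exists>v'\<in>words D' k.
      take (ell n m k) w = p \<and> rel w v0 \<and> near n m (\<beta> 0) v v0 \<and> near n m B v v' \<and>
      E.hi ^ (k - ell n m k) * card D' ^ k \<le> C * card D ^ k * F.mass (ell n m k) v \<and>
      E.hi ^ (k - ell n m k) * F.mass (ell n m k) v'
        \<le> C * E.lo ^ (k - ell n m k) * F.mass (ell n m k) v"
    using extremal_image by (metis (no_types, lifting))
  have B: "B < m ^ B" using E.m_ge by (meson less_exp order_less_le_trans power_mono zero_le)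
  define C' where "C' = Suc C * n ^ Suc B"
  have "1 \<le> n ^ Suc B" using E.n_pos by (simp add: Suc_leI)
  hence "C * 1 \<le> Suc C * n ^ Suc B" by (intro mult_le_mono) auto
  hence CC': "C \<le> C'" by (simp add: C'_def)
  show thesis
  proof (rule that[of C' t])
    show "0 < C'" using E.n_pos by (simp add: C'_def)
    fix k p assume large: "Suc t < k - ell n m k" and p: "p \<in> words D (ell n m k)"
    define l where "l = ell n m k"
    define L where "L = k - l"
    obtain w v0 v v' where *: "w \<in> words D k" "v0 \<in> words D' k" "v \<in> words D' k" "v' \<in> words D' k"
      "take l w = p" "rel w v0" "near n m (\<beta> 0) v v0" "near n m B v v'"
      and 1: "E.hi ^ L * card D' ^ k \<le> C * card D ^ k * F.mass l v"
      and 2: "E.hi ^ L * F.mass l v' \<le> C * E.lo ^ L * F.mass l v"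
      using ext[OF large p] unfolding l_def L_def by blast
    obtain b b' e s s' where b: "(b, b') \<in> {(0, m - 1), (m - 1, 0)}"
      and drop: "drop l (map snd v) = s @ replicate e b @ s'"
      and 3: "F.mass l v * fiber D' b' ^ e \<le> n ^ Suc B * F.mass l v' * fiber D' b ^ e"
      using F.near_mass[OF *(3,4,8) B, of l] by blast
    have pos: "0 < F.mass l v" "0 < F.mass l v'" using F.mass_pos * by blast+
    have "(E.hi ^ L * fiber D' b' ^ e) * (F.mass l v * F.mass l v') =
        (E.hi ^ L * F.mass l v') * (F.mass l v * fiber D' b' ^ e)" by (simp add: algebra_simps)
    also have "\<dots> \<le> (C * E.lo ^ L * F.mass l v) * (n ^ Suc B * F.mass l v' * fiber D' b ^ e)"
      by (rule mult_le_mono[OF 2 3])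
    also have "\<dots> = (C * n ^ Suc B * E.lo ^ L * fiber D' b ^ e) * (F.mass l v * F.mass l v')"
      by (simp add: algebra_simps)
    finally have 4: "E.hi ^ L * fiber D' b' ^ e \<le> C * n ^ Suc B * E.lo ^ L * fiber D' b ^ e"
      using pos by simp
    have "E.hi ^ L * F.lo ^ e \<le> E.hi ^ L * fiber D' b' ^ e"
      using b by (intro mult_le_mono2 power_mono) (auto simp: F.lo_def)
    also note 4
    also have "C * n ^ Suc B * E.lo ^ L * fiber D' b ^ e \<le> C' * E.lo ^ L * F.hi ^ e"
      using b unfolding C'_def by (intro mult_le_mono le_refl power_mono) (auto simp: F.hi_def)
    finally have 5: "E.hi ^ L * F.lo ^ e \<le> C' * E.lo ^ L * F.hi ^ e" .
    note 1
    also have "C * card D ^ k * F.mass l v \<le> C' * card D ^ k * F.mass l v"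
      by (intro mult_le_mono CC' le_refl)
    finally have 6: "E.hi ^ L * card D' ^ k \<le> C' * card D ^ k * F.mass l v" .
    have "b \<in> {0, m - 1}" using b by auto
    with * drop 5 6 show "\<exists>w\<in>words D k. \<exists>v0\<in>words D' k. \<exists>v\<in>words D' k. \<exists>b e s s'.
      take (ell n m k) w = p \<and> rel w v0 \<and> near n m (\<beta> 0) v v0 \<and>
      E.hi ^ (k - ell n m k) * card D' ^ k \<le> C' * card D ^ k * F.mass (ell n m k) v \<and>
      b \<in> {0, m - 1} \<and> drop (ell n m k) (map snd v) = s @ replicate e b @ s' \<and>
      E.hi ^ (k - ell n m k) * F.lo ^ e \<le> C' * E.lo ^ (k - ell n m k) * F.hi ^ e"
      unfolding l_def L_def by blast
  qed
qed

lemma eventually_large: "\<forall>\<^sub>F k in sequentially. c < k - ell n m k"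
  using filterlim_minus_ell[OF E.m_ge E.m_less]
  unfolding filterlim_at_top Suc_le_eq[symmetric] by blast

text \<open>A run satisfies \<open>e \<le> L\<close>, and \<open>F.lo < F.hi\<close>, so
  \<open>(E.hi / E.lo) ^ L\<close> is at most a constant times \<open>(F.hi / F.lo) ^ L\<close>;
  then \<open>L\<close> tends to infinity.\<close>

lemma ratio_le: "E.hi * F.lo \<le> E.lo * F.hi"
proof -
  obtain C t where C: "0 < C" and ext: "\<And>k p. Suc t < k - ell n m k \<Longrightarrow> p \<in> words D (ell n m k) \<Longrightarrow>
    \<exists>w\<in>words D k. \<exists>v0\<in>words D' k. \<exists>v\<in>words D' k. \<exists>b e s s'.
      take (ell n m k) w = p \<and> rel w v0 \<and> near n m (\<beta> 0) v v0 \<and>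
      E.hi ^ (k - ell n m k) * card D' ^ k \<le> C * card D ^ k * F.mass (ell n m k) v \<and>
      b \<in> {0, m - 1} \<and> drop (ell n m k) (map snd v) = s @ replicate e b @ s' \<and>
      E.hi ^ (k - ell n m k) * F.lo ^ e \<le> C * E.lo ^ (k - ell n m k) * F.hi ^ e"
    by (rule extremal_structure) (rule that)
  have "real (E.hi * F.lo) \<le> real (E.lo * F.hi)"
  proof (rule power_growth_le[OF filterlim_minus_ell[OF E.m_ge E.m_less]])
    show "0 < real (E.lo * F.hi)" using E.lo_pos F.lo_pos F.lo_less_hi by simp
    show "\<forall>\<^sub>F k in sequentially. real (E.hi * F.lo) ^ (k - ell n m k)
        \<le> real C * real (E.lo * F.hi) ^ (k - ell n m k)"
      using eventually_large[of "Suc t"]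
    proof eventually_elim
      case (elim k)
      define l where "l = ell n m k"
      define L where "L = k - l"
      obtain p where p: "p \<in> words D l" using words_nonempty[OF E.D_nonempty] by blast
      obtain v b e s s' where v: "v \<in> words D' k" "drop l (map snd v) = s @ replicate e b @ s'"
        and le: "E.hi ^ L * F.lo ^ e \<le> C * E.lo ^ L * F.hi ^ e"
        using ext[OF elim] p unfolding l_def L_def by blast
      have "length (drop l (map snd v)) = L"
        using words_drop[OF F.snd_word[OF v(1)], of l] by (simp only: words_def L_def mem_Collect_eq)
      hence "e \<le> L" using v by simp
      then obtain i where i: "L = e + i" using le_Suc_ex by blast
      have "(E.hi * F.lo) ^ L = (E.hi ^ L * F.lo ^ e) * F.lo ^ i"
        by (simp add: power_mult_distrib i power_add algebra_simps)
      also have "\<dots> \<le> (C * E.lo ^ L * F.hi ^ e) * F.hi ^ i"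
        using F.lo_less_hi by (intro mult_le_mono le power_mono) auto
      also have "\<dots> = C * (E.lo * F.hi) ^ L"
        by (simp add: power_mult_distrib i power_add algebra_simps)
      finally show ?case unfolding l_def L_def by (metis of_nat_le_iff of_nat_mult of_nat_power)
    qed
  qed simp
  thus ?thesis by (simp only: of_nat_le_iff)
qed

lemma ratio_eq: "E.hi * F.lo = E.lo * F.hi"
proof -
  interpret sw: carry_equiv n m D' D "\<lambda>v w. rel w v" \<beta> by (rule swapped_carry)
  show ?thesis using ratio_le sw.ratio_le by (simp add: mult.commute)
qed

text \<open>Since both ratios equal the same \<open>\<Lambda> > 1\<close>,
  \<open>extremal_structure\<close> reads \<open>\<Lambda> ^ L \<le> C * \<Lambda> ^ e\<close>,
  which bounds \<open>L - e = length s + length s'\<close>. The mass of \<open>v\<close> is then at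
  most a constant times \<open>F.hi ^ L\<close>.\<close>

lemma extremal_cells:
  obtains C e0 t where "\<And>k p. Suc t < k - ell n m k \<Longrightarrow> p \<in> words D (ell n m k) \<Longrightarrow>
    \<exists>w\<in>words D k. \<exists>v0\<in>words D' k. \<exists>v\<in>words D' k. \<exists>b e s s'.
      take (ell n m k) w = p \<and> rel w v0 \<and> near n m (\<beta> 0) v v0 \<and>
      E.hi ^ (k - ell n m k) * card D' ^ k \<le> C * card D ^ k * F.hi ^ (k - ell n m k) \<and>
      b \<in> {0, m - 1} \<and> drop (ell n m k) (map snd v) = s @ replicate e b @ s' \<and>
      length s \<le> e0 \<and> length s' \<le> e0"
proof -
  obtain C t where C: "0 < C" and ext: "\<And>k p. Suc t < k - ell n m k \<Longrightarrow> p \<in> words D (ell n m k) \<Longrightarrow>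
    \<exists>w\<in>words D k. \<exists>v0\<in>words D' k. \<exists>v\<in>words D' k. \<exists>b e s s'.
      take (ell n m k) w = p \<and> rel w v0 \<and> near n m (\<beta> 0) v v0 \<and>
      E.hi ^ (k - ell n m k) * card D' ^ k \<le> C * card D ^ k * F.mass (ell n m k) v \<and>
      b \<in> {0, m - 1} \<and> drop (ell n m k) (map snd v) = s @ replicate e b @ s' \<and>
      E.hi ^ (k - ell n m k) * F.lo ^ e \<le> C * E.lo ^ (k - ell n m k) * F.hi ^ e"
    by (rule extremal_structure) (rule that)
  define \<Lambda> where "\<Lambda> = real E.hi / real E.lo"
  have \<Lambda>: "1 < \<Lambda>" using E.lo_pos E.lo_less_hi by (simp add: \<Lambda>_def)
  have "real E.hi * real F.lo = real E.lo * real F.hi"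
    using ratio_eq by (metis of_nat_mult)
  hence \<Lambda>': "\<Lambda> = real F.hi / real F.lo"
    using E.lo_pos F.lo_pos by (simp add: \<Lambda>_def field_simps)
  obtain e0 where e0: "real C < \<Lambda> ^ e0" using real_arch_pow[OF \<Lambda>] by blast
  show thesis
  proof (rule that[of t "C * (n ^ e0 * n ^ e0)" e0])
    fix k p assume large: "Suc t < k - ell n m k" and p: "p \<in> words D (ell n m k)"
    define l where "l = ell n m k"
    define L where "L = k - l"
    obtain w v0 v b e s s' where *: "w \<in> words D k" "v0 \<in> words D' k" "v \<in> words D' k"
      "take l w = p" "rel w v0" "near n m (\<beta> 0) v v0"
      and 1: "E.hi ^ L * card D' ^ k \<le> C * card D ^ k * F.mass l v"
      and b: "b \<in> {0, m - 1}" and drop: "drop l (map snd v) = s @ replicate e b @ s'"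
      and 2: "E.hi ^ L * F.lo ^ e \<le> C * E.lo ^ L * F.hi ^ e"
      using ext[OF large p] unfolding l_def L_def by blast
    have "length (drop l (map snd v)) = L"
      using words_drop[OF F.snd_word[OF *(3)], of l] by (simp only: words_def L_def mem_Collect_eq)
    hence L: "L = e + (length s + length s')" using drop by simp
    have "real (E.hi ^ L * F.lo ^ e) \<le> real (C * E.lo ^ L * F.hi ^ e)"
      using 2 by (simp only: of_nat_le_iff)
    hence "\<Lambda> ^ L \<le> real C * (real F.hi / real F.lo) ^ e"
      using E.lo_pos F.lo_pos by (simp add: \<Lambda>_def power_divide field_simps)
    hence "\<Lambda> ^ (length s + length s') * \<Lambda> ^ e \<le> real C * \<Lambda> ^ e"
      unfolding \<Lambda>'[symmetric] L by (simp add: power_add mult.commute)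
    hence "\<Lambda> ^ (length s + length s') \<le> real C" using \<Lambda> by simp
    also have "\<dots> < \<Lambda> ^ e0" by (rule e0)
    finally have "length s + length s' < e0" using \<Lambda> by simp
    hence short: "length s \<le> e0" "length s' \<le> e0" by auto
    have "F.mass l v = rowprod (fiber D') s * fiber D' b ^ e * rowprod (fiber D') s'"
      unfolding F.mass_def drop by simp
    also have "\<dots> \<le> n ^ e0 * F.hi ^ e * n ^ e0"
      using b by (intro mult_le_mono rowprod_le' power_mono short F.n_pos)
        (auto simp: F.hi_def F.fiber_le)
    also have "\<dots> \<le> n ^ e0 * F.hi ^ L * n ^ e0"
      using F.lo_less_hi L by (intro mult_le_mono le_refl power_increasing) auto
    finally have "C * card D ^ k * F.mass l v \<le> C * card D ^ k * (n ^ e0 * F.hi ^ L * n ^ e0)"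
      by (rule mult_le_mono2)
    from order_trans[OF 1 this] have "E.hi ^ L * card D' ^ k \<le> C * (n ^ e0 * n ^ e0) * card D ^ k * F.hi ^ L"
      by (simp add: algebra_simps)
    with * b drop short show "\<exists>w\<in>words D k. \<exists>v0\<in>words D' k. \<exists>v\<in>words D' k. \<exists>b e s s'.
      take (ell n m k) w = p \<and> rel w v0 \<and> near n m (\<beta> 0) v v0 \<and>
      E.hi ^ (k - ell n m k) * card D' ^ k
        \<le> C * (n ^ e0 * n ^ e0) * card D ^ k * F.hi ^ (k - ell n m k) \<and>
      b \<in> {0, m - 1} \<and> drop (ell n m k) (map snd v) = s @ replicate e b @ s' \<and>
      length s \<le> e0 \<and> length s' \<le> e0"
      unfolding l_def L_def by blast
  qed
qed

text \<open>Each of the \<open>card D ^ l\<close> prefixes yields an extremal cell with its own key.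
  The image cell is given by its first \<open>l\<close> letters and a triple from the finite set
  \<open>A\<close>, which does not depend on \<open>k\<close>; \<open>transport\<close> bounds how
  many prefixes share an image.\<close>

lemma card_le: "card D \<le> card D'"
proof -
  obtain C e0 t where ext: "\<And>k p. Suc t < k - ell n m k \<Longrightarrow> p \<in> words D (ell n m k) \<Longrightarrow>
    \<exists>w\<in>words D k. \<exists>v0\<in>words D' k. \<exists>v\<in>words D' k. \<exists>b e s s'.
      take (ell n m k) w = p \<and> rel w v0 \<and> near n m (\<beta> 0) v v0 \<and>
      E.hi ^ (k - ell n m k) * card D' ^ k \<le> C * card D ^ k * F.hi ^ (k - ell n m k) \<and>
      b \<in> {0, m - 1} \<and> drop (ell n m k) (map snd v) = s @ replicate e b @ s' \<and>
      length s \<le> e0 \<and> length s' \<le> e0"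
    by (rule extremal_cells) (rule that)
  define Sh where "Sh = {s. set s \<subseteq> F.rows \<and> length s \<le> e0}"
  define A where "A = Sh \<times> {0, m - 1} \<times> Sh"
  define M where "M = (2 * \<beta> (2 * \<beta> 0) + 1) ^ 2"
  have finA: "finite A" unfolding A_def Sh_def
    using F.finite_D by (intro finite_cartesian_product finite_lists_length_le) auto
  have "real (card D) \<le> real (card D')"
  proof (rule power_growth_le[OF filterlim_ell[OF E.m_ge E.m_less]])
    show "0 < real (card D')" using F.card_D_pos by simp
    show "\<forall>\<^sub>F k in sequentially. real (card D) ^ ell n m k
        \<le> real (M * card A) * real (card D') ^ ell n m k"
      using eventually_large[of "Suc t"]
    proof eventually_elim
      case (elim k)
      define l where "l = ell n m k"
      define L where "L = k - l"
      define end_run where "end_run v \<longleftrightarrow> (\<exists>b e s s'. b \<in> {0, m - 1} \<and>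
          drop l (map snd v) = s @ replicate e b @ s' \<and> length s \<le> e0 \<and> length s' \<le> e0)" for v :: "(nat \<times> nat) list"
      define near_image where "near_image w v \<longleftrightarrow> (\<exists>v0\<in>words D' k. rel w v0 \<and> near n m (\<beta> 0) v v0)" for w v
      have "\<exists>w v. w \<in> words D k \<and> take l w = p \<and> v \<in> words D' k \<and> near_image w v \<and> end_run v"
        if "p \<in> words D l" for p
        using ext[OF elim, of p] that unfolding l_def end_run_def near_image_def by blast
      then obtain \<omega> \<psi> where \<omega>: "\<And>p. p \<in> words D l \<Longrightarrow> \<omega> p \<in> words D k"
        "\<And>p. p \<in> words D l \<Longrightarrow> take l (\<omega> p) = p"
        and \<psi>: "\<And>p. p \<in> words D l \<Longrightarrow> \<psi> p \<in> words D' k"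
        "\<And>p. p \<in> words D l \<Longrightarrow> near_image (\<omega> p) (\<psi> p)"
        "\<And>p. p \<in> words D l \<Longrightarrow> end_run (\<psi> p)"
        by metis
      define S where "S = \<omega> ` words D l"
      define \<phi> where "\<phi> w = \<psi> (take l w)" for w
      have \<phi>\<omega>: "\<phi> (\<omega> p) = \<psi> p" if "p \<in> words D l" for p using \<omega>(2)[OF that] by (simp add: \<phi>_def)
      have "inj_on \<omega> (words D l)" by (rule inj_on_inverseI[where g = "take l"]) (rule \<omega>(2))
      hence cardS: "card S = card D ^ l"
        unfolding S_def using E.finite_D by (simp add: card_image card_words)
      have inj: "inj_on (key l) S"
        unfolding S_def by (rule inj_onI) (use \<omega>(2) in \<open>auto simp: key_def\<close>)
      have "(\<Sum>w\<in>S. 1) \<le> M * (\<Sum>z\<in>key l ` \<phi> ` S. (1::nat))"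
        unfolding M_def l_def
      proof (rule transport[where g = "\<lambda>_. 1" and B = "\<beta> 0"])
        show "S \<subseteq> words D k" using \<omega>(1) by (auto simp: S_def)
        show "inj_on (key (ell n m k)) S" using inj by (simp add: l_def)
        fix w assume "w \<in> S"
        then obtain p where "p \<in> words D l" "w = \<omega> p" by (auto simp: S_def)
        thus "\<phi> w \<in> words D' k" "\<exists>v\<in>words D' k. rel w v \<and> near n m (\<beta> 0) (\<phi> w) v"
          using \<psi>(1,2) \<phi>\<omega> by (simp_all add: near_image_def)
      qed
      hence le: "card D ^ l \<le> M * card (key l ` \<phi> ` S)" using cardS by simp
      \<comment> \<open>The run length need not be encoded: the total length \<open>L\<close>
        determines it.\<close>
      let ?h = "\<lambda>(x, s, b, s'). (x, s @ replicate (L - length s - length s') b @ s')"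
      have "key l ` \<phi> ` S \<subseteq> ?h ` (words D' l \<times> A)"
      proof
        fix z assume "z \<in> key l ` \<phi> ` S"
        then obtain p where p: "p \<in> words D l" "z = key l (\<psi> p)" by (auto simp: S_def \<phi>\<omega>)
        obtain b e s s' where b: "b \<in> {0, m - 1}" "drop l (map snd (\<psi> p)) = s @ replicate e b @ s'"
            "length s \<le> e0" "length s' \<le> e0"
          using \<psi>(3)[OF p(1)] unfolding end_run_def by blast
        have d: "drop l (map snd (\<psi> p)) \<in> words F.rows L"
          unfolding L_def by (intro words_drop F.snd_word \<psi>(1) p(1))
        have "s \<in> Sh" "s' \<in> Sh" "e = L - length s - length s'"
          using d b by (auto simp: words_def Sh_def)
        moreover have "take l (\<psi> p) \<in> words D' l"
          using words_take[OF \<psi>(1)[OF p(1)]] E.lev_le by (simp add: l_def)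
        ultimately show "z \<in> ?h ` (words D' l \<times> A)"
          using p b by (intro image_eqI[where x = "(take l (\<psi> p), s, b, s')"]) (auto simp: key_def A_def)
      qed
      hence "card (key l ` \<phi> ` S) \<le> card (?h ` (words D' l \<times> A))"
        using finA finite_words[OF F.finite_D] by (intro card_mono) auto
      also have "\<dots> \<le> card (words D' l \<times> A)"
        using finA finite_words[OF F.finite_D] by (intro card_image_le) auto
      also have "\<dots> = card D' ^ l * card A"
        using F.finite_D by (simp add: card_cartesian_product card_words)
      finally have "M * card (key l ` \<phi> ` S) \<le> M * (card D' ^ l * card A)" by (rule mult_le_mono2)
      from order_trans[OF le this] have "card D ^ l \<le> (M * card A) * card D' ^ l" by (simp add: algebra_simps)
      thus ?case unfolding l_def by (metis of_nat_le_iff of_nat_mult of_nat_power)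
    qed
  qed simp
  thus ?thesis by simp
qed

lemma card_eq: "card D = card D'"
proof -
  interpret sw: carry_equiv n m D' D "\<lambda>v w. rel w v" \<beta> by (rule swapped_carry)
  show ?thesis using card_le sw.card_le by simp
qed

text \<open>Since the cardinalities agree, the \<open>k\<close>-th powers in
  \<open>extremal_cells\<close> cancel.\<close>

lemma hi_le: "E.hi \<le> F.hi"
proof -
  obtain C e0 t where ext: "\<And>k p. Suc t < k - ell n m k \<Longrightarrow> p \<in> words D (ell n m k) \<Longrightarrow>
    \<exists>w\<in>words D k. \<exists>v0\<in>words D' k. \<exists>v\<in>words D' k. \<exists>b e s s'.
      take (ell n m k) w = p \<and> rel w v0 \<and> near n m (\<beta> 0) v v0 \<and>
      E.hi ^ (k - ell n m k) * card D' ^ k \<le> C * card D ^ k * F.hi ^ (k - ell n m k) \<and>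
      b \<in> {0, m - 1} \<and> drop (ell n m k) (map snd v) = s @ replicate e b @ s' \<and>
      length s \<le> e0 \<and> length s' \<le> e0"
    by (rule extremal_cells) (rule that)
  have "real E.hi \<le> real F.hi"
  proof (rule power_growth_le[OF filterlim_minus_ell[OF E.m_ge E.m_less]])
    show "0 < real F.hi" using F.lo_less_hi by simp
    show "\<forall>\<^sub>F k in sequentially. real E.hi ^ (k - ell n m k) \<le> real C * real F.hi ^ (k - ell n m k)"
      using eventually_large[of "Suc t"]
    proof eventually_elim
      case (elim k)
      obtain p where "p \<in> words D (ell n m k)" using words_nonempty[OF E.D_nonempty] by blast
      hence "E.hi ^ (k - ell n m k) * card D' ^ k \<le> C * card D ^ k * F.hi ^ (k - ell n m k)"
        using ext[OF elim] by blast
      hence "E.hi ^ (k - ell n m k) \<le> C * F.hi ^ (k - ell n m k)"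
        using E.card_D_pos unfolding card_eq by (simp add: algebra_simps)
      thus ?case by (metis of_nat_le_iff of_nat_mult of_nat_power)
    qed
  qed simp
  thus ?thesis by simp
qed

lemma hi_eq: "E.hi = F.hi" and lo_eq: "E.lo = F.lo"
proof -
  interpret sw: carry_equiv n m D' D "\<lambda>v w. rel w v" \<beta> by (rule swapped_carry)
  show "E.hi = F.hi" using hi_le sw.hi_le by simp
  thus "E.lo = F.lo" using ratio_eq F.lo_less_hi by simp
qed

lemma power_sum_mono: "(\<Sum>j\<in>E.rows. fiber D j ^ q) \<le> (\<Sum>j\<in>F.rows. fiber D' j ^ q)"
proof -
  let ?p = "\<Sum>j\<in>E.rows. fiber D j ^ q" and ?p' = "\<Sum>j\<in>F.rows. fiber D' j ^ q"
  obtain C where C: "\<forall>k. ?p ^ (k - ell n m k) \<le> C * ?p' ^ (k - ell n m k)"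
    using power_sum_le[OF card_eq] by blast
  have "0 < ?p'"
    using F.finite_D F.D_nonempty by (intro sum_pos) (auto simp flip: F.fiber_pos)
  hence pos: "0 < real ?p'" by (simp only: of_nat_0_less_iff)
  have "real ?p \<le> real ?p'"
  proof (rule power_growth_le[OF filterlim_minus_ell[OF E.m_ge E.m_less] _ pos])
    show "\<forall>\<^sub>F k in sequentially. real ?p ^ (k - ell n m k) \<le> real C * real ?p' ^ (k - ell n m k)"
      using C by (intro always_eventually allI) (metis of_nat_le_iff of_nat_mult of_nat_power)
  qed simp
  thus ?thesis by (simp only: of_nat_le_iff)
qed

lemma power_sum_eq: "(\<Sum>j\<in>E.rows. fiber D j ^ q) = (\<Sum>j\<in>F.rows. fiber D' j ^ q)"
proof -
  interpret sw: carry_equiv n m D' D "\<lambda>v w. rel w v" \<beta> by (rule swapped_carry)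
  show ?thesis using power_sum_mono sw.power_sum_mono by (rule antisym)
qed

end

section \<open>The carpet\<close>

text \<open>By linearity the sums of every polynomial over the two families agree. A polynomial that
  vanishes at all occurring values except \<open>v\<close> turns this into equality of the
  multiplicities of \<open>v\<close>.\<close>

lemma power_sums_imp_permutes:
  fixes a a' :: "nat \<Rightarrow> nat"
  assumes "finite A" and sums: "\<And>q::nat. (\<Sum>j\<in>A. a j ^ q) = (\<Sum>j\<in>A. a' j ^ q)"
  shows "\<exists>p. p permutes A \<and> (\<forall>j\<in>A. a j = a' (p j))"
proof -
  have poly_sum: "(\<Sum>j\<in>A. poly P (real (b j))) = (\<Sum>i\<le>degree P. coeff P i * real (\<Sum>j\<in>A. b j ^ i))"
    for P :: "real poly" and b :: "nat \<Rightarrow> nat"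
    unfolding poly_altdef
    by (subst sum.swap) (simp add: sum_distrib_left)
  have poly_eq: "(\<Sum>j\<in>A. poly P (real (a j))) = (\<Sum>j\<in>A. poly P (real (a' j)))" for P :: "real poly"
    unfolding poly_sum sums ..
  have count: "card {j \<in> A. a j = v} = card {j \<in> A. a' j = v}" for v
  proof -
    define U where "U = (a ` A \<union> a' ` A) - {v}"
    have finU: "finite U" using assms(1) by (simp add: U_def)
    define P where "P = (\<Prod>u\<in>U. [:- real u, 1:])"
    have P: "poly P (real x) = (\<Prod>u\<in>U. real x - real u)" for x
      by (simp add: P_def poly_prod)
    have nz: "poly P (real v) \<noteq> 0" using finU unfolding P by (auto simp: U_def)
    have z: "poly P (real x) = 0" if "x \<in> U" for x using finU that unfolding P by auto
    have eval: "(\<Sum>j\<in>A. poly P (real (b j))) = real (card {j \<in> A. b j = v}) * poly P (real v)"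
      if "b ` A \<subseteq> insert v U" for b
    proof -
      have "(\<Sum>j\<in>A. poly P (real (b j))) = (\<Sum>j\<in>A. if b j = v then poly P (real v) else 0)"
        using that z by (intro sum.cong) auto
      also have "\<dots> = real (card {j \<in> A. b j = v}) * poly P (real v)"
        using assms(1) by (simp add: sum.If_cases Int_def)
      finally show ?thesis .
    qed
    have sub: "a ` A \<subseteq> insert v U" "a' ` A \<subseteq> insert v U" by (auto simp: U_def)
    have "real (card {j \<in> A. a j = v}) * poly P (real v) =
        real (card {j \<in> A. a' j = v}) * poly P (real v)"
      unfolding eval[symmetric, of a, OF sub(1)] eval[symmetric, of a', OF sub(2)] by (rule poly_eq)
    thus ?thesis using nz by simp
  qed
  have "image_mset a (mset_set A) = image_mset a' (mset_set A)"
    using assms(1) by (intro multiset_eqI) (simp add: count_image_mset_eq_card_vimage count)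
  from image_mset_eq_implies_permutes[OF assms(1) this] show ?thesis by metis
qed

section \<open>Cylinders, and existence and uniqueness of the carpet\<close>

lemma dist_le_sum_coords:
  fixes p q :: "real \<times> real"
  shows "dist p q \<le> \<bar>fst p - fst q\<bar> + \<bar>snd p - snd q\<bar>"
  by (simp add: dist_prod_def dist_real_def sqrt_sum_squares_le_sum_abs)

lemma coord_le_dist:
  fixes p q :: "real \<times> real"
  shows "\<bar>fst p - fst q\<bar> \<le> dist p q" "\<bar>snd p - snd q\<bar> \<le> dist p q"
  using dist_fst_le[of p q] dist_snd_le[of p q] by (simp_all add: dist_real_def)

text \<open>The composition of the maps \<open>carpet_map\<close> along \<open>w\<close>, first
  letter outermost, in closed form; its translation part is the integer grid position of the
  cylinder.\<close>

definition word_map :: "nat \<Rightarrow> nat \<Rightarrow> (nat \<times> nat) list \<Rightarrow> real \<times> real \<Rightarrow> real \<times> real" where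
  "word_map n m w z = ((fst z + real (digval n (map fst w))) / real n ^ length w,
     (snd z + real (digval m (map snd w))) / real m ^ length w)"

lemma word_map_Nil [simp]: "word_map n m [] z = z"
  by (simp add: word_map_def)

lemma word_map_append:
  assumes "0 < n" "0 < m"
  shows "word_map n m (u @ v) z = word_map n m u (word_map n m v z)"
  using assms by (simp add: word_map_def digval_append power_add field_simps)

lemma word_map_Cons:
  assumes "0 < n" "0 < m"
  shows "word_map n m (d # w) z = carpet_map n m d (word_map n m w z)"
  using word_map_append[OF assms, of "[d]" w z]
  by (simp add: word_map_def[of _ _ "[d]"] carpet_map_def)

definition attractor :: "nat \<Rightarrow> nat \<Rightarrow> (nat \<times> nat) set \<Rightarrow> (real \<times> real) set \<Rightarrow> bool" where
  "attractor n m D E \<longleftrightarrow> compact E \<and> E \<noteq> {} \<and> E = (\<Union>d\<in>D. carpet_map n m d ` E)"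

context digit_set begin

lemma m_pos: "0 < m" using m_ge by simp

lemma attractor_words:
  assumes "attractor n m D E"
  shows "E = (\<Union>w\<in>words D k. word_map n m w ` E)"
proof (induction k)
  case (Suc k)
  have "E = (\<Union>d\<in>D. carpet_map n m d ` (\<Union>w\<in>words D k. word_map n m w ` E))"
    using assms Suc by (simp add: attractor_def)
  also have "\<dots> = (\<Union>w\<in>words D (Suc k). word_map n m w ` E)"
    unfolding words_Suc by (force simp: word_map_Cons[OF n_pos m_pos])
  finally show ?case .
qed simp

lemma word_map_contracts:
  "dist (word_map n m w y) (word_map n m w z) \<le> 2 * dist y z / real m ^ length w"
proof -
  have le: "\<bar>fst y - fst z\<bar> / real n ^ length w \<le> \<bar>fst y - fst z\<bar> / real m ^ length w"
    using m_less m_ge by (intro divide_left_mono power_mono) auto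
  have "dist (word_map n m w y) (word_map n m w z)
      \<le> \<bar>fst y - fst z\<bar> / real n ^ length w + \<bar>snd y - snd z\<bar> / real m ^ length w"
    using dist_le_sum_coords[of "word_map n m w y" "word_map n m w z"]
    by (simp add: word_map_def diff_divide_distrib[symmetric] abs_divide)
  also have "\<dots> \<le> dist y z / real m ^ length w + dist y z / real m ^ length w"
    using m_ge coord_le_dist[of y z]
    by (intro add_mono order_trans[OF le] divide_right_mono) auto
  finally show ?thesis by simp
qed

text \<open>A point of \<open>E\<close> lies in a cylinder of every depth \<open>k\<close>; moving
  its preimage into \<open>F\<close> gives a point of \<open>F\<close> at distance of order m^-k,
  and \<open>F\<close> is closed. By symmetry attractors are unique, as the definite description in
  \<open>carpet\<close> demands.\<close>

lemma attractor_subset: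
  assumes E: "attractor n m D E" and F: "attractor n m D F"
  shows "E \<subseteq> F"
proof
  fix x assume x: "x \<in> E"
  have "bounded (E \<union> F)" using E F by (simp add: attractor_def compact_imp_bounded)
  then obtain R where R: "\<And>y z. y \<in> E \<union> F \<Longrightarrow> z \<in> E \<union> F \<Longrightarrow> dist y z \<le> R"
    unfolding bounded_two_points by blast
  have "\<exists>y\<in>F. dist y x < e" if "0 < e" for e
  proof -
    obtain k where k: "2 * R / e < real m ^ k" using real_arch_pow[of "real m"] m_ge by auto
    obtain w z where w: "w \<in> words D k" "z \<in> E" "x = word_map n m w z"
      using x attractor_words[OF E, of k] by blast
    obtain z' where z': "z' \<in> F" using F by (auto simp: attractor_def)
    have "word_map n m w z' \<in> F" using attractor_words[OF F, of k] w z' by blast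
    moreover have "dist (word_map n m w z') x \<le> 2 * dist z' z / real m ^ k"
      using word_map_contracts[of w z' z] w by (simp add: words_def)
    moreover have "2 * dist z' z / real m ^ k \<le> 2 * R / real m ^ k"
      using R[of z' z] z' w by (intro divide_right_mono) auto
    moreover have "2 * R / real m ^ k < e"
      using k that m_pos by (simp add: field_simps)
    ultimately show ?thesis by (intro bexI[of _ "word_map n m w z'"]) auto
  qed
  hence "x \<in> closure F" by (simp add: closure_approachable)
  thus "x \<in> F" using F by (simp add: attractor_def compact_imp_closed)
qed

fun approx :: "nat \<Rightarrow> (real \<times> real) set" where
  "approx 0 = {0..1} \<times> {0..1}"
| "approx (Suc k) = (\<Union>d\<in>D. carpet_map n m d ` approx k)"

lemma continuous_carpet_map: "continuous_on S (carpet_map n m d)"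
  unfolding carpet_map_def using m_pos n_pos by (intro continuous_intros) auto

lemma compact_approx: "compact (approx k)"
  by (induction k) (auto intro!: compact_Times compact_UN finite_D compact_continuous_image
      continuous_carpet_map)

lemma carpet_map_unit:
  assumes "d \<in> D" "z \<in> {0..1} \<times> {0..1}"
  shows "carpet_map n m d z \<in> {0..1} \<times> {0..1}"
proof -
  have "Suc (fst d) \<le> n" "Suc (snd d) \<le> m" using assms(1) D_sub by auto
  hence "real (fst d) + 1 \<le> real n" "real (snd d) + 1 \<le> real m" by linarith+
  thus ?thesis using assms(2) m_pos n_pos by (auto simp: carpet_map_def)
qed

lemma approx_decreasing: "approx (Suc k) \<subseteq> approx k"
proof (induction k)
  case 0
  show ?case unfolding approx.simps using carpet_map_unit by blast
next
  case (Suc k)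
  have "(\<Union>d\<in>D. carpet_map n m d ` approx (Suc k)) \<subseteq> (\<Union>d\<in>D. carpet_map n m d ` approx k)"
    using Suc by blast
  thus ?case by (simp only: approx.simps(2))
qed

lemma approx_antimono: "k \<le> k' \<Longrightarrow> approx k' \<subseteq> approx k"
  by (rule lift_Suc_antimono_le[of approx]) (use approx_decreasing in auto)

lemma inj_carpet_map: "inj (carpet_map n m d)"
  using m_pos n_pos by (auto simp: inj_def carpet_map_def prod_eq_iff)

lemma approx_nonempty: "approx k \<noteq> {}"
  using D_nonempty by (induction k) auto

lemma attractor_exists: "attractor n m D (\<Inter>k. approx k)"
  unfolding attractor_def
proof (intro conjI)
  show "compact (\<Inter>k. approx k)" by (intro compact_Inter) (auto intro: compact_approx)
  show "(\<Inter>k. approx k) \<noteq> {}"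
    using compact_nest[of approx] compact_approx approx_nonempty approx_antimono by blast
  show "(\<Inter>k. approx k) = (\<Union>d\<in>D. carpet_map n m d ` (\<Inter>k. approx k))"
  proof (intro equalityI subsetI)
    fix x assume x: "x \<in> (\<Inter>k. approx k)"
    \<comment> \<open>The first digit may depend on \<open>k\<close>. One of the finitely many
      digits serves for infinitely many \<open>k\<close>, hence for all, since \<open>approx\<close>
      decreases; injectivity then moves the map out of the intersection.\<close>
    have "\<forall>k. \<exists>d. d \<in> D \<and> x \<in> carpet_map n m d ` approx k"
    proof
      fix k
      have "x \<in> approx (Suc k)" using x by blast
      thus "\<exists>d. d \<in> D \<and> x \<in> carpet_map n m d ` approx k" by auto
    qed
    then obtain \<delta> where \<delta>: "\<And>k. \<delta> k \<in> D" "\<And>k. x \<in> carpet_map n m (\<delta> k) ` approx k" by metis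
    have "finite (range \<delta>)" using finite_D \<delta>(1) by (meson finite_subset image_subsetI)
    then obtain k0 where inf: "infinite {k. \<delta> k = \<delta> k0}"
      using pigeonhole_infinite[of UNIV \<delta>] by auto
    have "x \<in> carpet_map n m (\<delta> k0) ` approx k" for k
    proof -
      obtain k' where "k < k'" "\<delta> k' = \<delta> k0" using inf by (metis (mono_tags) infinite_nat_iff_unbounded mem_Collect_eq)
      thus ?thesis using \<delta>(2)[of k'] approx_antimono[of k k'] by auto
    qed
    hence "x \<in> (\<Inter>k. carpet_map n m (\<delta> k0) ` approx k)" by blast
    also have "\<dots> = carpet_map n m (\<delta> k0) ` (\<Inter>k. approx k)"
      by (rule image_INT[symmetric, where C = UNIV and j = 0]) (use inj_carpet_map in auto)
    finally show "x \<in> (\<Union>d\<in>D. carpet_map n m d ` (\<Inter>k. approx k))" using \<delta>(1) by blast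
  next
    fix x assume "x \<in> (\<Union>d\<in>D. carpet_map n m d ` (\<Inter>k. approx k))"
    hence "x \<in> approx (Suc k)" for k by auto
    hence "x \<in> approx k" for k using approx_decreasing by blast
    thus "x \<in> (\<Inter>k. approx k)" by blast
  qed
qed

lemma carpet_eq_approx: "carpet n m D = (\<Inter>k. approx k)"
  unfolding carpet_def
proof (rule the_equality)
  show "compact (\<Inter>k. approx k) \<and> (\<Inter>k. approx k) \<noteq> {} \<and>
      (\<Inter>k. approx k) = (\<Union>d\<in>D. carpet_map n m d ` (\<Inter>k. approx k))"
    using attractor_exists unfolding attractor_def .
  fix E assume "compact E \<and> E \<noteq> {} \<and> E = (\<Union>d\<in>D. carpet_map n m d ` E)"
  hence "attractor n m D E" unfolding attractor_def .
  thus "E = (\<Inter>k. approx k)" using attractor_subset attractor_exists by blast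
qed

abbreviation K :: "(real \<times> real) set" where "K \<equiv> carpet n m D"

lemma attractor_carpet: "attractor n m D K"
  unfolding carpet_eq_approx by (rule attractor_exists)

lemma K_unit: "K \<subseteq> {0..1} \<times> {0..1}"
  unfolding carpet_eq_approx using approx.simps(1) by blast

lemma K_words: "K = (\<Union>w\<in>words D k. word_map n m w ` K)"
  by (rule attractor_words[OF attractor_carpet])

lemma K_nonempty: "K \<noteq> {}" and compact_K: "compact K"
  using attractor_carpet by (auto simp: attractor_def)

lemma word_map_K_subset: "w \<in> words D k \<Longrightarrow> word_map n m w ` K \<subseteq> K"
  using K_words by blast

section \<open>Grid positions and Euclidean distance\<close>

lemma word_map_take:
  assumes "w \<in> words D k"
  shows "word_map n m w ` K \<subseteq> word_map n m (take l w) ` K"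
proof -
  have "word_map n m w z = word_map n m (take l w) (word_map n m (drop l w) z)" for z
    using word_map_append[OF n_pos m_pos, of "take l w" "drop l w"] by simp
  thus ?thesis using word_map_K_subset[OF words_drop[OF assms, of l]] by blast
qed

text \<open>Both ends are closed because a point on a grid line may belong to cylinders on either
  side; a coordinate determines its index only up to 1.\<close>

lemma cell_bounds:
  assumes "w \<in> words D k" "p \<in> word_map n m w ` K" "l \<le> k"
  shows "real (digval n (map fst (take l w))) \<le> fst p * real n ^ l"
    "fst p * real n ^ l \<le> real (digval n (map fst (take l w))) + 1"
    "real (digval m (map snd w)) \<le> snd p * real m ^ k"
    "snd p * real m ^ k \<le> real (digval m (map snd w)) + 1"
proof -
  have len: "length (take l w) = l" "length w = k" using assms by (auto simp: words_def)
  obtain z where z: "z \<in> K" "p = word_map n m (take l w) z" using word_map_take[OF assms(1)] assms(2) by blast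
  obtain y where y: "y \<in> K" "p = word_map n m w y" using assms(2) by blast
  have "fst p = (fst z + real (digval n (map fst (take l w)))) / real n ^ l"
    unfolding z(2) word_map_def len by simp
  hence "fst p * real n ^ l = fst z + real (digval n (map fst (take l w)))"
    using n_pos by simp
  moreover have "snd p * real m ^ k = snd y + real (digval m (map snd w))"
    using y m_pos by (simp add: word_map_def len)
  moreover have "0 \<le> fst z \<and> fst z \<le> 1 \<and> 0 \<le> snd y \<and> snd y \<le> 1"
    using K_unit z(1) y(1) by (auto simp: mem_Times_iff)
  ultimately show "real (digval n (map fst (take l w))) \<le> fst p * real n ^ l"
    "fst p * real n ^ l \<le> real (digval n (map fst (take l w))) + 1"
    "real (digval m (map snd w)) \<le> snd p * real m ^ k"
    "snd p * real m ^ k \<le> real (digval m (map snd w)) + 1" by auto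
qed

text \<open>Indices within \<open>B\<close> leave scaled coordinates within \<open>B + 1\<close>.
  The unit is m^-k for rows and n^-l < n m^-k for columns, which sum to the factor
  \<open>n + 1\<close>.\<close>

lemma near_imp_dist:
  assumes "w \<in> words D k" "w' \<in> words D k" "p \<in> word_map n m w ` K" "p' \<in> word_map n m w' ` K"
    and near: "near n m B w w'"
  shows "dist p p' \<le> (real B + 1) * (real n + 1) / real m ^ k"
proof -
  have len: "length w = k" "length w' = k" using assms by (auto simp: words_def)
  note b = cell_bounds[OF assms(1,3) lev_le] cell_bounds[OF assms(2,4) lev_le]
  have "\<bar>real (digval n (map fst (take (lev k) w))) - real (digval n (map fst (take (lev k) w')))\<bar> \<le> real B"
    "\<bar>real (digval m (map snd w)) - real (digval m (map snd w'))\<bar> \<le> real B"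
    using near unfolding near_def len by linarith+
  hence "\<bar>fst p * real n ^ lev k - fst p' * real n ^ lev k\<bar> \<le> real B + 1"
    "\<bar>snd p * real m ^ k - snd p' * real m ^ k\<bar> \<le> real B + 1"
    using b by linarith+
  hence 1: "\<bar>fst p - fst p'\<bar> * real n ^ lev k \<le> real B + 1"
    and 2: "\<bar>snd p - snd p'\<bar> * real m ^ k \<le> real B + 1"
    using n_pos m_pos by (simp_all add: left_diff_distrib[symmetric] abs_mult)
  have "m ^ k \<le> n * n ^ lev k" using ell_bounds(2)[OF m_ge m_less, of k] by simp
  hence "real m ^ k \<le> real n * real n ^ lev k" by (metis of_nat_le_iff of_nat_mult of_nat_power)
  hence "\<bar>fst p - fst p'\<bar> * real m ^ k \<le> \<bar>fst p - fst p'\<bar> * (real n * real n ^ lev k)"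
    by (intro mult_left_mono) auto
  also have "\<dots> = (\<bar>fst p - fst p'\<bar> * real n ^ lev k) * real n" by simp
  also have "\<dots> \<le> (real B + 1) * real n" by (rule mult_right_mono[OF 1]) simp
  finally have "(\<bar>fst p - fst p'\<bar> + \<bar>snd p - snd p'\<bar>) * real m ^ k \<le> (real B + 1) * (real n + 1)"
    using 2 by (simp add: algebra_simps)
  hence "\<bar>fst p - fst p'\<bar> + \<bar>snd p - snd p'\<bar> \<le> (real B + 1) * (real n + 1) / real m ^ k"
    using m_pos by (simp add: pos_le_divide_eq)
  thus ?thesis using dist_le_sum_coords[of p p'] by linarith
qed

text \<open>Here \<open>n ^ lev k \<le> m ^ k\<close> is used for the columns; the 1 in
  \<open>\<delta> + 1\<close> is the uncertainty of an index given the coordinate.\<close>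

lemma dist_imp_near:
  assumes "w \<in> words D k" "w' \<in> words D k" "p \<in> word_map n m w ` K" "p' \<in> word_map n m w' ` K"
    and dist: "dist p p' \<le> \<delta> / real m ^ k" and "\<delta> + 1 \<le> real B"
  shows "near n m B w w'"
proof -
  have len: "length w = k" "length w' = k" using assms by (auto simp: words_def)
  note b = cell_bounds[OF assms(1,3) lev_le] cell_bounds[OF assms(2,4) lev_le]
  have d: "dist p p' * real m ^ k \<le> \<delta>" using dist m_pos by (simp add: pos_le_divide_eq)
  have "n ^ lev k \<le> m ^ k" by (rule ell_bounds(1)[OF m_ge m_less])
  hence "real n ^ lev k \<le> real m ^ k" by (metis of_nat_le_iff of_nat_power)
  hence "\<bar>fst p - fst p'\<bar> * real n ^ lev k \<le> dist p p' * real m ^ k"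
    using coord_le_dist by (intro mult_mono) auto
  moreover have "\<bar>snd p - snd p'\<bar> * real m ^ k \<le> dist p p' * real m ^ k"
    using coord_le_dist by (intro mult_right_mono) auto
  ultimately have "\<bar>fst p * real n ^ lev k - fst p' * real n ^ lev k\<bar> \<le> \<delta>"
    "\<bar>snd p * real m ^ k - snd p' * real m ^ k\<bar> \<le> \<delta>"
    using d by (simp_all add: left_diff_distrib[symmetric] abs_mult)
  hence "\<bar>real (digval n (map fst (take (lev k) w))) - real (digval n (map fst (take (lev k) w')))\<bar> \<le> real B"
    "\<bar>real (digval m (map snd w)) - real (digval m (map snd w'))\<bar> \<le> real B"
    using b assms(6) by linarith+
  thus ?thesis unfolding near_def len by linarith
qed

end

lemma coarse_equiv_of_lipschitz:
  assumes E: "digit_set n m D" and F: "digit_set n m D'"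
    and lip: "lipschitz_equivalent (carpet n m D) (carpet n m D')"
  shows "\<exists>rel \<beta>. coarse_equiv n m D D' rel \<beta>"
proof -
  interpret E: digit_set n m D by (rule E)
  interpret F: digit_set n m D' by (rule F)
  obtain f C where bij: "bij_betw f E.K F.K" and C: "C > 0"
    and lower: "\<And>x y. x \<in> E.K \<Longrightarrow> y \<in> E.K \<Longrightarrow> inverse C * dist x y \<le> dist (f x) (f y)"
    and upper: "\<And>x y. x \<in> E.K \<Longrightarrow> y \<in> E.K \<Longrightarrow> dist (f x) (f y) \<le> C * dist x y"
    using lip unfolding lipschitz_equivalent_def by blast
  define rel where "rel w v \<longleftrightarrow> (\<exists>p. p \<in> word_map n m w ` E.K \<and> f p \<in> word_map n m v ` F.K)" for w v
  \<comment> \<open>The distance from \<open>near_imp_dist\<close>, times the Lipschitz constant,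
    plus the 1 of \<open>dist_imp_near\<close>. The inverse map has the same constant
    \<open>C\<close>, so one \<beta> serves both directions.\<close>
  define \<beta> where "\<beta> B = nat \<lceil>C * ((real B + 1) * (real n + 1)) + 1\<rceil>" for B
  have \<beta>: "C * ((real B + 1) * (real n + 1)) + 1 \<le> real (\<beta> B)" for B
    unfolding \<beta>_def by linarith
  have "coarse_equiv n m D D' rel \<beta>"
  proof unfold_locales
    fix w k assume w: "w \<in> words D k"
    obtain z where "z \<in> E.K" using E.K_nonempty by blast
    let ?p = "word_map n m w z"
    have "?p \<in> E.K" using E.word_map_K_subset[OF w] \<open>z \<in> E.K\<close> by blast
    hence "f ?p \<in> F.K" using bij by (auto simp: bij_betw_def)
    then obtain v where "v \<in> words D' k" "f ?p \<in> word_map n m v ` F.K" using F.K_words[of k] by blast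
    thus "\<exists>v\<in>words D' k. rel w v" using \<open>z \<in> E.K\<close> unfolding rel_def by blast
  next
    fix v k assume v: "v \<in> words D' k"
    obtain z where "z \<in> F.K" using F.K_nonempty by blast
    hence "word_map n m v z \<in> F.K" using F.word_map_K_subset[OF v] by blast
    then obtain p where p: "p \<in> E.K" "f p = word_map n m v z" using bij by (force simp: bij_betw_def)
    then obtain w where "w \<in> words D k" "p \<in> word_map n m w ` E.K" using E.K_words[of k] by blast
    thus "\<exists>w\<in>words D k. rel w v" using p \<open>z \<in> F.K\<close> unfolding rel_def by auto
  next
    fix w w1 v v1 k B
    assume w: "w \<in> words D k" "w1 \<in> words D k" and v: "v \<in> words D' k" "v1 \<in> words D' k"
      and "rel w v" "rel w1 v1"
    then obtain p p1 where p: "p \<in> word_map n m w ` E.K" "p1 \<in> word_map n m w1 ` E.K"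
      "f p \<in> word_map n m v ` F.K" "f p1 \<in> word_map n m v1 ` F.K" unfolding rel_def by blast
    have K: "p \<in> E.K" "p1 \<in> E.K" using p E.word_map_K_subset w by blast+
    {
      assume "near n m B w w1"
      have "dist (f p) (f p1) \<le> C * dist p p1" by (rule upper[OF K])
      also have "\<dots> \<le> C * ((real B + 1) * (real n + 1) / real m ^ k)"
        using E.near_imp_dist[OF w p(1,2) \<open>near n m B w w1\<close>] C by (intro mult_left_mono) auto
      finally have "dist (f p) (f p1) \<le> C * ((real B + 1) * (real n + 1)) / real m ^ k" by simp
      thus "near n m (\<beta> B) v v1" by (rule F.dist_imp_near[OF v p(3,4) _ \<beta>])
    next
      assume "near n m B v v1"
      have "dist p p1 \<le> C * dist (f p) (f p1)" using lower[OF K] C by (simp add: field_simps)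
      also have "\<dots> \<le> C * ((real B + 1) * (real n + 1) / real m ^ k)"
        using F.near_imp_dist[OF v p(3,4) \<open>near n m B v v1\<close>] C by (intro mult_left_mono) auto
      finally have "dist p p1 \<le> C * ((real B + 1) * (real n + 1)) / real m ^ k" by simp
      thus "near n m (\<beta> B) w w1" by (rule E.dist_imp_near[OF w p(1,2) _ \<beta>])
    }
  next
    fix w v k K assume "w \<in> words D K" "v \<in> words D' K" "rel w v"
    thus "rel (take k w) (take k v)"
      unfolding rel_def using E.word_map_take[of w K k] F.word_map_take[of v K k] by blast
  qed
  thus ?thesis by blast
qed

section \<open>The uniform Bernoulli measure\<close>

context digit_set begin

definition bernoulli_measure :: "(real \<times> real) measure \<Rightarrow> bool" where
  "bernoulli_measure M \<longleftrightarrow> prob_space M \<and> sets M = sets borel \<and> measure M K = 1 \<and>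
     (\<forall>A\<in>sets borel.
        measure M A = (\<Sum>d\<in>D. measure (distr M borel (carpet_map n m d)) A) / real (card D))"

lemma closed_K: "closed K"
  using compact_K by (rule compact_imp_closed)

lemma word_map_measurable: "word_map n m w \<in> borel_measurable borel"
  unfolding word_map_def using m_pos n_pos
  by (intro borel_measurable_continuous_onI continuous_intros) auto

lemma carpet_map_measurable: "carpet_map n m d \<in> borel_measurable borel"
  by (intro borel_measurable_continuous_onI continuous_carpet_map)

lemma bernoulli_measure_words:
  assumes "bernoulli_measure M" "A \<in> sets borel"
  shows "measure M A = (\<Sum>w\<in>words D k. measure M (word_map n m w -` A)) / real (card D) ^ k"
  using assms(2)
proof (induction k arbitrary: A)
  case (Suc k)
  interpret prob_space M using assms(1) by (simp add: bernoulli_measure_def)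
  have sets: "sets M = sets borel" using assms(1) by (simp add: bernoulli_measure_def)
  have space: "space M = UNIV" using sets_eq_imp_space_eq[OF sets] by simp
  have step: "measure (distr M borel (carpet_map n m d)) A =
      (\<Sum>w\<in>words D k. measure M (word_map n m (d # w) -` A)) / real (card D) ^ k" for d
  proof -
    have meas: "carpet_map n m d \<in> borel_measurable M"
      using carpet_map_measurable measurable_cong_sets[OF sets refl] by blast
    have "carpet_map n m d -` A \<in> sets borel"
      using measurable_sets[OF carpet_map_measurable Suc.prems] by simp
    hence "measure (distr M borel (carpet_map n m d)) A =
        (\<Sum>w\<in>words D k. measure M (word_map n m w -` (carpet_map n m d -` A))) / real (card D) ^ k"
      using Suc.IH measure_distr[OF meas Suc.prems] space by simp
    moreover have "word_map n m w -` (carpet_map n m d -` A) = word_map n m (d # w) -` A" for w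
      by (auto simp: word_map_Cons[OF n_pos m_pos])
    ultimately show ?thesis by simp
  qed
  have "measure M A = (\<Sum>d\<in>D. measure (distr M borel (carpet_map n m d)) A) / real (card D)"
    using assms(1) Suc.prems by (simp add: bernoulli_measure_def)
  also have "\<dots> = (\<Sum>d\<in>D. \<Sum>w\<in>words D k. measure M (word_map n m (d # w) -` A)) /
      real (card D) ^ Suc k"
    unfolding step by (simp add: sum_divide_distrib mult.commute)
  also have "(\<Sum>d\<in>D. \<Sum>w\<in>words D k. measure M (word_map n m (d # w) -` A)) =
      (\<Sum>w\<in>words D (Suc k). measure M (word_map n m w -` A))"
    unfolding words_Suc
    by (subst sum.reindex) (auto simp: inj_on_def sum.cartesian_product split_def intro!: sum.cong)
  finally show ?case .
qed (simp add: vimage_def)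

text \<open>The measure of \<open>A\<close> is an average over words of measures of pulled back
  sets; such a term is 0 if the cylinder misses \<open>A\<close>, and 1 if it lies in
  \<open>A\<close> (\<open>count_le_bernoulli_measure\<close>). Counting words avoids the question
  of overlapping cylinders.\<close>

lemma bernoulli_measure_le_count:
  assumes M: "bernoulli_measure M" and A: "A \<in> sets borel"
  shows "measure M A \<le> real (card {w \<in> words D k. word_map n m w ` K \<inter> A \<noteq> {}}) / real (card D) ^ k"
proof -
  interpret prob_space M using M by (simp add: bernoulli_measure_def)
  have sets: "sets M = sets borel" using M by (simp add: bernoulli_measure_def)
  have space: "space M = UNIV" using sets_eq_imp_space_eq[OF sets] by simp
  have K: "K \<in> sets M" "prob K = 1" using M closed_K sets by (auto simp: bernoulli_measure_def)
  have "measure M (word_map n m w -` A) \<le> (if word_map n m w ` K \<inter> A \<noteq> {} then 1 else 0)" for w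
  proof (cases "word_map n m w ` K \<inter> A = {}")
    case True
    have "word_map n m w -` A \<subseteq> space M - K" using True space by auto
    hence "measure M (word_map n m w -` A) \<le> measure M (space M - K)"
      using K(1) by (intro finite_measure_mono) auto
    also have "\<dots> = 0" using prob_compl[OF K(1)] K(2) by simp
    finally show ?thesis using True by simp
  qed simp
  hence "(\<Sum>w\<in>words D k. measure M (word_map n m w -` A)) \<le>
      (\<Sum>w\<in>words D k. if word_map n m w ` K \<inter> A \<noteq> {} then 1 else 0)"
    by (intro sum_mono)
  also have "\<dots> = real (card {w \<in> words D k. word_map n m w ` K \<inter> A \<noteq> {}})"
    using finite_words[OF finite_D] by (simp add: sum.If_cases Int_def)
  finally show ?thesis
    unfolding bernoulli_measure_words[OF M A, of k] by (intro divide_right_mono) auto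
qed

lemma count_le_bernoulli_measure:
  assumes M: "bernoulli_measure M" and A: "A \<in> sets borel"
  shows "real (card {w \<in> words D k. word_map n m w ` K \<subseteq> A}) / real (card D) ^ k \<le> measure M A"
proof -
  interpret prob_space M using M by (simp add: bernoulli_measure_def)
  have sets: "sets M = sets borel" using M by (simp add: bernoulli_measure_def)
  have K: "prob K = 1" using M by (auto simp: bernoulli_measure_def)
  have "(if word_map n m w ` K \<subseteq> A then 1 else 0) \<le> measure M (word_map n m w -` A)" for w
  proof (cases "word_map n m w ` K \<subseteq> A")
    case True
    have "word_map n m w -` A \<in> sets M"
      using measurable_sets[OF word_map_measurable A] sets by simp
    hence "prob K \<le> prob (word_map n m w -` A)" using True by (intro finite_measure_mono) auto
    thus ?thesis using K by simp
  qed simp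
  hence "(\<Sum>w\<in>words D k. if word_map n m w ` K \<subseteq> A then 1 else 0) \<le>
      (\<Sum>w\<in>words D k. measure M (word_map n m w -` A))"
    by (intro sum_mono)
  moreover have "(\<Sum>w\<in>words D k. if word_map n m w ` K \<subseteq> A then 1 else 0) =
      real (card {w \<in> words D k. word_map n m w ` K \<subseteq> A})"
    using finite_words[OF finite_D] by (simp add: sum.If_cases Int_def)
  ultimately show ?thesis
    unfolding bernoulli_measure_words[OF M A, of k] by (intro divide_right_mono) auto
qed

lemma K_dist_le:
  assumes "w \<in> words D k" "x \<in> word_map n m w ` K" "y \<in> word_map n m w ` K"
  shows "dist x y \<le> (real n + 1) / real m ^ k"
  using near_imp_dist[OF assms(1,1,2,3) near_refl, of 0] by simp

text \<open>A sufficiently small cylinder that meets \<open>A\<close> lies in its neighbourhood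
  \<open>B i\<close>, so the two word counts give \<open>measure M A \<le> measure N (B i)\<close>;
  the sets \<open>B i\<close> decrease to \<open>A\<close>. Uniqueness follows by symmetry, because
  closed sets form an intersection-stable generator.\<close>

lemma bernoulli_measure_closed_le:
  assumes M: "bernoulli_measure M" and N: "bernoulli_measure N" and A: "closed A"
  shows "measure M A \<le> measure N A"
proof (cases "A = {}")
  case False
  interpret N: prob_space N using N by (simp add: bernoulli_measure_def)
  have setsN: "sets N = sets borel" using N by (simp add: bernoulli_measure_def)
  define B where "B i = {x. infdist x A \<le> 1 / real (Suc i)}" for i
  have clB: "closed (B i)" for i
    unfolding B_def by (intro closed_Collect_le continuous_intros)
  have "measure M A \<le> measure N (B i)" for i
  proof -
    obtain k where k: "(real n + 1) * real (Suc i) < real m ^ k"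
      using real_arch_pow[of "real m"] m_ge by auto
    hence small: "(real n + 1) / real m ^ k \<le> 1 / real (Suc i)"
      using m_pos by (simp add: field_simps)
    have "measure M A \<le> real (card {w \<in> words D k. word_map n m w ` K \<inter> A \<noteq> {}}) / real (card D) ^ k"
      using A by (intro bernoulli_measure_le_count[OF M]) auto
    also have "{w \<in> words D k. word_map n m w ` K \<inter> A \<noteq> {}} \<subseteq> {w \<in> words D k. word_map n m w ` K \<subseteq> B i}"
    proof
      fix w assume w: "w \<in> {w \<in> words D k. word_map n m w ` K \<inter> A \<noteq> {}}"
      then obtain a where a: "a \<in> word_map n m w ` K" "a \<in> A" by blast
      have "infdist x A \<le> 1 / real (Suc i)" if "x \<in> word_map n m w ` K" for x
        using K_dist_le[of w k x a] w a that small by (intro infdist_le2[OF a(2)]) auto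
      thus "w \<in> {w \<in> words D k. word_map n m w ` K \<subseteq> B i}" using w by (auto simp: B_def)
    qed
    hence "real (card {w \<in> words D k. word_map n m w ` K \<inter> A \<noteq> {}}) / real (card D) ^ k \<le>
        real (card {w \<in> words D k. word_map n m w ` K \<subseteq> B i}) / real (card D) ^ k"
      using finite_words[OF finite_D] by (intro divide_right_mono of_nat_mono card_mono) auto
    also have "\<dots> \<le> measure N (B i)"
      using clB by (intro count_le_bernoulli_measure[OF N]) auto
    finally show ?thesis .
  qed
  moreover have "(\<lambda>i. measure N (B i)) \<longlonglongrightarrow> measure N (\<Inter>i. B i)"
  proof (rule N.finite_Lim_measure_decseq)
    show "range B \<subseteq> sets N" using clB setsN by auto
    show "decseq B" unfolding decseq_def B_def
      by (auto intro: order_trans simp: frac_le)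
  qed
  moreover have "(\<Inter>i. B i) = A"
  proof (intro equalityI subsetI)
    fix x assume "x \<in> (\<Inter>i. B i)"
    hence "infdist x A \<le> 1 / real (Suc i)" for i by (auto simp: B_def)
    hence "infdist x A \<le> 0"
      by (intro LIMSEQ_le_const[OF LIMSEQ_inverse_real_of_nat]) (auto simp: inverse_eq_divide)
    hence "infdist x A = 0" using infdist_nonneg[of x A] by simp
    thus "x \<in> A" using in_closed_iff_infdist_zero[OF A False] by simp
  qed (simp add: B_def)
  ultimately show ?thesis by (metis LIMSEQ_le_const)
qed simp

lemma bernoulli_measure_unique:
  assumes M: "bernoulli_measure M" and N: "bernoulli_measure N"
  shows "M = N"
proof (rule measure_eqI_generator_eq[where E = "Collect closed" and \<Omega> = UNIV and A = "\<lambda>_. UNIV"])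
  interpret M: prob_space M using M by (simp add: bernoulli_measure_def)
  interpret N: prob_space N using N by (simp add: bernoulli_measure_def)
  have sets: "sets M = sets borel" "sets N = sets borel"
    using M N by (auto simp: bernoulli_measure_def)
  have "sets (borel :: (real \<times> real) measure) = sigma_sets UNIV (Collect closed)"
    unfolding borel_eq_closed by (rule sets_measure_of) simp
  thus "sets M = sigma_sets UNIV (Collect closed)" "sets N = sigma_sets UNIV (Collect closed)"
    using sets by simp_all
  fix X :: "(real \<times> real) set" assume "X \<in> Collect closed"
  hence "measure M X = measure N X"
    using bernoulli_measure_closed_le[OF M N] bernoulli_measure_closed_le[OF N M] by (simp add: antisym)
  thus "emeasure M X = emeasure N X"
    by (simp add: M.emeasure_eq_measure N.emeasure_eq_measure)
next
  interpret M: prob_space M using M by (simp add: bernoulli_measure_def)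
  show "emeasure M UNIV \<noteq> \<infinity>" by simp
qed (auto simp: Int_stable_def)

end

text \<open>Capping the digits at \<open>b - 1\<close> makes the series converge for every stream,
  so \<open>radix_sum_Stream\<close> holds with no condition on the tail. Digits of streams over
  \<open>D\<close> are below the cap.\<close>

definition radix_sum :: "nat \<Rightarrow> ('a \<Rightarrow> nat) \<Rightarrow> 'a stream \<Rightarrow> real" where
  "radix_sum b g s = (\<Sum>i. real (min (g (s !! i)) (b - 1)) / real b ^ Suc i)"

lemma radix_sum_Stream:
  assumes "2 \<le> b" "g x < b"
  shows "radix_sum b g (x ## s) = (radix_sum b g s + real (g x)) / real b"
    and "0 \<le> radix_sum b g s" "radix_sum b g s \<le> 1"
proof -
  have b: "0 < real b" "1 < real b" using assms(1) by auto
  have geo: "(\<lambda>i. real (b - 1) / real b ^ Suc i) sums 1"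
  proof -
    have "(\<lambda>i. (1 - 1 / real b) * (1 / real b) ^ i) sums ((1 - 1 / real b) * (1 / (1 - 1 / real b)))"
      using b by (intro sums_mult geometric_sums) auto
    moreover have "(1 - 1 / real b) * (1 / (1 - 1 / real b)) = 1" using b by simp
    moreover have "(1 - 1 / real b) * (1 / real b) ^ i = real (b - 1) / real b ^ Suc i" for i
    proof -
      have "1 - 1 / real b = real (b - 1) / real b" using b assms(1) by (simp add: diff_divide_distrib of_nat_diff)
      thus ?thesis by (simp add: power_one_over)
    qed
    ultimately show ?thesis by simp
  qed
  have bound: "norm (real (min (g (s !! i)) (b - 1)) / real b ^ Suc i) \<le> real (b - 1) / real b ^ Suc i" for s i
    using b by (simp add: divide_right_mono)
  have summable: "summable (\<lambda>i. real (min (g (s !! i)) (b - 1)) / real b ^ Suc i)" for s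
    by (rule summable_comparison_test'[OF sums_summable[OF geo], of 0]) (rule bound)
  show "0 \<le> radix_sum b g s" unfolding radix_sum_def by (intro suminf_nonneg summable) simp
  have "radix_sum b g s \<le> (\<Sum>i. real (b - 1) / real b ^ Suc i)"
    unfolding radix_sum_def
    by (intro suminf_le summable sums_summable[OF geo]) (use bound[of s] in auto)
  thus "radix_sum b g s \<le> 1" using sums_unique[OF geo] by simp
  have "radix_sum b g (x ## s) = (\<Sum>i. real (min (g ((x ## s) !! Suc i)) (b - 1)) / real b ^ Suc (Suc i)) +
      real (min (g ((x ## s) !! 0)) (b - 1)) / real b ^ Suc 0"
    using suminf_split_head[OF summable, of "x ## s"] unfolding radix_sum_def by linarith
  also have "min (g ((x ## s) !! 0)) (b - 1) = g x" using assms(2) by simp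
  also have "(\<Sum>i. real (min (g ((x ## s) !! Suc i)) (b - 1)) / real b ^ Suc (Suc i)) =
      (\<Sum>i. real (min (g (s !! i)) (b - 1)) / real b ^ Suc i / real b)"
    by (simp add: field_simps)
  also have "\<dots> = radix_sum b g s / real b"
    unfolding radix_sum_def by (rule suminf_divide[OF summable])
  finally show "radix_sum b g (x ## s) = (radix_sum b g s + real (g x)) / real b"
    by (simp add: add_divide_distrib)
qed

context digit_set begin

definition coding :: "(nat \<times> nat) stream \<Rightarrow> real \<times> real" where
  "coding s = (radix_sum n fst s, radix_sum m snd s)"

lemma digits_less: "d \<in> D \<Longrightarrow> fst d < n \<and> snd d < m"
  using D_sub by auto

lemma coding_Stream: "d \<in> D \<Longrightarrow> coding (d ## s) = carpet_map n m d (coding s)"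
  using digits_less[of d] m_ge m_less
  by (simp add: coding_def carpet_map_def radix_sum_Stream(1))

lemma coding_in_approx: "s \<in> streams D \<Longrightarrow> coding s \<in> approx k"
proof (induction k arbitrary: s)
  case 0
  have "2 \<le> n" "0 < n" "0 < m" using m_ge m_less by auto
  \<comment> \<open>The letter \<open>(0, 0)\<close> has digits in range and so instantiates
    \<open>x\<close> in \<open>radix_sum_Stream\<close>.\<close>
  thus ?case using m_ge
    radix_sum_Stream(2,3)[of n fst "(0, 0)" s] radix_sum_Stream(2,3)[of m snd "(0, 0)" s]
    by (simp add: coding_def)
next
  case (Suc k)
  obtain d s' where s: "s = d ## s'" "d \<in> D" "s' \<in> streams D"
    using Suc.prems by (cases s) (auto simp: streams_Stream)
  thus ?case using Suc.IH[OF s(3)] by (auto simp: coding_Stream)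
qed

lemma coding_in_K: "s \<in> streams D \<Longrightarrow> coding s \<in> K"
  unfolding carpet_eq_approx using coding_in_approx by blast

text \<open>The witness is the image under \<open>coding\<close> of an independent uniform digit
  sequence. Splitting off the first digit gives self-similarity by \<open>coding_Stream\<close>, and
  almost every sequence has all its digits in \<open>D\<close>.\<close>

lemma bernoulli_measure_exists: "\<exists>M. bernoulli_measure M"
proof -
  let ?P = "measure_pmf (pmf_of_set D)"
  let ?S = "stream_space ?P"
  interpret S: prob_space ?S by (rule prob_space.prob_space_stream_space[OF prob_space_measure_pmf])
  have space: "space ?S = UNIV" by (simp add: space_stream_space)
  have snth: "(\<lambda>s. h (s !! i)) \<in> borel_measurable ?S" for h :: "nat \<times> nat \<Rightarrow> real" and i
    by (rule measurable_compose[OF measurable_snth]) simp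
  have radix: "radix_sum b g \<in> borel_measurable ?S" for b and g :: "nat \<times> nat \<Rightarrow> nat"
    unfolding radix_sum_def by (intro borel_measurable_suminf snth)
  have coding [measurable]: "coding \<in> borel_measurable ?S"
    unfolding coding_def by (intro borel_measurable_Pair radix)
  define M where "M = distr ?S borel coding"
  have meas: "measure M A = measure ?S (coding -` A)" if "A \<in> sets borel" for A
    unfolding M_def using that space by (simp add: measure_distr[OF coding])
  have sim: "measure M A = (\<Sum>d\<in>D. measure (distr M borel (carpet_map n m d)) A) / real (card D)"
    if A: "A \<in> sets borel" for A
  proof -
    have pre: "coding -` B \<in> sets ?S" if "B \<in> sets borel" for B
      using measurable_sets[OF coding that] space by simp
    have cA: "carpet_map n m d -` A \<in> sets borel" for d
      using measurable_sets[OF carpet_map_measurable A] by simp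
    have "ennreal (measure ?S (coding -` A)) = emeasure ?S (coding -` A)"
      by (simp add: S.emeasure_eq_measure)
    also have "\<dots> = (\<integral>\<^sup>+d. emeasure ?S {s \<in> space ?S. d ## s \<in> coding -` A} \<partial>?P)"
      by (rule prob_space.emeasure_stream_space[OF prob_space_measure_pmf pre[OF A]])
    also have "\<dots> = (\<Sum>d\<in>D. emeasure ?S {s \<in> space ?S. d ## s \<in> coding -` A}) / ennreal (real (card D))"
      using nn_integral_pmf_of_set[OF D_nonempty finite_D] by (simp add: ennreal_of_nat_eq_real_of_nat)
    also have "(\<Sum>d\<in>D. emeasure ?S {s \<in> space ?S. d ## s \<in> coding -` A}) =
        (\<Sum>d\<in>D. ennreal (measure ?S (coding -` (carpet_map n m d -` A))))"
    proof (rule sum.cong)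
      fix d assume "d \<in> D"
      hence "{s \<in> space ?S. d ## s \<in> coding -` A} = coding -` (carpet_map n m d -` A)"
        using space by (auto simp: coding_Stream)
      thus "emeasure ?S {s \<in> space ?S. d ## s \<in> coding -` A} =
          ennreal (measure ?S (coding -` (carpet_map n m d -` A)))"
        by (simp add: S.emeasure_eq_measure)
    qed simp
    also have "\<dots> / ennreal (real (card D)) =
        ennreal ((\<Sum>d\<in>D. measure ?S (coding -` (carpet_map n m d -` A))) / real (card D))"
      using card_D_pos by (simp add: sum_ennreal divide_ennreal sum_nonneg)
    finally have "measure ?S (coding -` A) =
        (\<Sum>d\<in>D. measure ?S (coding -` (carpet_map n m d -` A))) / real (card D)"
      by (simp add: sum_nonneg)
    moreover have "measure (distr M borel (carpet_map n m d)) A = measure ?S (coding -` (carpet_map n m d -` A))" for d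
    proof -
      have "carpet_map n m d \<in> borel_measurable M"
        unfolding M_def using carpet_map_measurable by simp
      from measure_distr[OF this A] show ?thesis
        using meas[OF cA] by (simp add: M_def)
    qed
    ultimately show ?thesis using meas[OF A] by simp
  qed
  have "AE s in ?S. stream_all (\<lambda>d. d \<in> D) s"
    using D_nonempty finite_D by (intro prob_space.AE_stream_all[OF prob_space_measure_pmf]) (simp_all add: AE_measure_pmf_iff)
  hence "AE s in ?S. s \<in> streams D"
    by (simp add: streams_iff_sset subset_iff Ball_def)
  hence "AE s in ?S. s \<in> coding -` K" using coding_in_K by (auto elim!: eventually_mono)
  hence "measure M K = 1"
    using meas[of K] closed_K S.prob_eq_1[of "coding -` K"] measurable_sets[OF coding, of K] space by simp
  moreover have "prob_space M" unfolding M_def by (rule S.prob_space_distr[OF coding])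
  ultimately have "bernoulli_measure M"
    using sim by (simp add: bernoulli_measure_def M_def)
  thus ?thesis by blast
qed

lemma uniform_bernoulli: "bernoulli_measure (uniform_bernoulli n m D)"
proof -
  obtain M where M: "bernoulli_measure M" using bernoulli_measure_exists by blast
  have "uniform_bernoulli n m D = (THE M. bernoulli_measure M)"
    unfolding uniform_bernoulli_def bernoulli_measure_def ..
  also have "\<dots> = M" using M bernoulli_measure_unique by blast
  finally show ?thesis using M by simp
qed

section \<open>Doubling of the measure from comparable neighbouring masses\<close>

lemma card_near_words:
  assumes "w \<in> words D k" and "\<And>u. u \<in> words D k \<Longrightarrow> near n m B u w \<Longrightarrow> mass (lev k) u \<le> c"
  shows "card {u \<in> words D k. near n m B u w} \<le> (2 * B + 1) ^ 2 * c"
proof -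
  let ?S = "{u \<in> words D k. near n m B u w}" and ?key = "key (lev k)"
  have fin: "finite ?S" using finite_words[OF finite_D] by simp
  have "card ?S = (\<Sum>z\<in>?key ` ?S. card {u. u \<in> ?S \<and> ?key u = z})"
    unfolding card_eq_sum by (rule sum.image_gen[OF fin])
  also have "\<dots> \<le> (\<Sum>z\<in>?key ` ?S. c)"
  proof (rule sum_mono)
    fix z assume "z \<in> ?key ` ?S"
    then obtain v where v: "v \<in> words D k" "near n m B v w" "z = ?key v" by blast
    have "card {u. u \<in> ?S \<and> ?key u = z} \<le> card {u \<in> words D k. ?key u = ?key v}"
      using finite_words[OF finite_D] v(3) by (intro card_mono) auto
    also have "\<dots> = mass (lev k) v" by (rule card_same_key[OF v(1) lev_le])
    also have "\<dots> \<le> c" using assms(2) v by blast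
    finally show "card {u. u \<in> ?S \<and> ?key u = z} \<le> c" .
  qed
  also have "\<dots> = card (?key ` ?S) * c" by simp
  also have "\<dots> \<le> (2 * B + 1) ^ 2 * c"
    by (intro mult_le_mono1 card_near_keys(2)[where ?w0.0 = w]) auto
  finally show ?thesis .
qed

text \<open>At the level \<open>k\<close> matching \<open>r\<close>, the ball of radius
  \<open>r\<close> contains every cylinder of the approximate square around \<open>x\<close>, and
  the ball of radius \<open>2 * r\<close> meets only cylinders within \<open>B\<close> grid steps,
  whose number \<open>card_near_words\<close> bounds.\<close>

lemma doubling_of_mass_comparable:
  assumes M: "bernoulli_measure M"
    and comp: "\<And>B. \<exists>c. \<forall>k. \<forall>w\<in>words D k. \<forall>u\<in>words D k. near n m B u w \<longrightarrow>
      mass (lev k) u \<le> c * mass (lev k) w"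
  shows "doubling_measure M"
proof -
  interpret prob_space M using M by (simp add: bernoulli_measure_def)
  have sets: "sets M = sets borel" using M by (simp add: bernoulli_measure_def)
  have space: "space M = UNIV" using sets_eq_imp_space_eq[OF sets] by simp
  have K: "K \<in> sets M" "prob K = 1" using M closed_K sets by (auto simp: bernoulli_measure_def)
  define c0 where "c0 = real n + 1"
  have c0: "0 < c0" by (simp add: c0_def)
  \<comment> \<open>Minimality of \<open>k\<close> gives
    \<open>2 * r \<le> 2 * real m * c0 / real m ^ k\<close>; the extra 1 is required by
    \<open>dist_imp_near\<close>.\<close>
  define B where "B = nat \<lceil>2 * real m * c0\<rceil> + 1"
  have B: "2 * real m * c0 + 1 \<le> real B" unfolding B_def by linarith
  obtain c where c: "\<And>k w u. w \<in> words D k \<Longrightarrow> u \<in> words D k \<Longrightarrow> near n m B u w \<Longrightarrow>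
      mass (lev k) u \<le> c * mass (lev k) w"
    using comp[of B] by blast
  define C where "C = max 1 (real ((2 * B + 1) ^ 2 * c))"
  have "measure M (ball x (2 * r)) / measure M (ball x r) \<le> C"
    if x: "x \<in> measure_support M" and r: "0 < r" for x r
  proof -
    have "x \<in> K"
    proof (rule ccontr)
      assume "x \<notin> K"
      hence "open (- K)" "x \<in> - K" using closed_K by auto
      then obtain e where e: "0 < e" "ball x e \<subseteq> - K" using open_contains_ball by blast
      have "measure M (ball x e) \<le> measure M (space M - K)"
        using e sets.compl_sets[OF K(1)] space by (intro finite_measure_mono) auto
      also have "\<dots> = 0" using prob_compl[OF K(1)] K(2) by simp
      finally show False using x e(1) by (auto simp: measure_support_def not_less[symmetric])
    qed
    define k where "k = (LEAST k. c0 / real m ^ k < r)"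
    have "\<exists>k. c0 / real m ^ k < r"
    proof -
      obtain k where "c0 / r < real m ^ k" using real_arch_pow[of "real m"] m_ge by auto
      thus ?thesis using r m_pos by (intro exI[of _ k]) (simp add: field_simps)
    qed
    hence k: "c0 / real m ^ k < r" unfolding k_def by (rule LeastI_ex)
    obtain w where w: "w \<in> words D k" "x \<in> word_map n m w ` K" using \<open>x \<in> K\<close> K_words[of k] by blast
    have lower: "real (mass (lev k) w) / real (card D) ^ k \<le> measure M (ball x r)"
    proof -
      have "{u \<in> words D k. key (lev k) u = key (lev k) w} \<subseteq> {u \<in> words D k. word_map n m u ` K \<subseteq> ball x r}"
      proof
        fix u assume "u \<in> {u \<in> words D k. key (lev k) u = key (lev k) w}"
        hence u: "u \<in> words D k" "near n m 0 w u" using near_0_key[OF w(1)] by auto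
        have "y \<in> ball x r" if "y \<in> word_map n m u ` K" for y
          using near_imp_dist[OF w(1) u(1) w(2) that u(2)] k by (simp add: c0_def)
        thus "u \<in> {u \<in> words D k. word_map n m u ` K \<subseteq> ball x r}" using u(1) by blast
      qed
      hence "mass (lev k) w \<le> card {u \<in> words D k. word_map n m u ` K \<subseteq> ball x r}"
        using finite_words[OF finite_D]
        unfolding card_same_key[OF w(1) lev_le, symmetric] by (intro card_mono) auto
      hence "real (mass (lev k) w) / real (card D) ^ k \<le>
          real (card {u \<in> words D k. word_map n m u ` K \<subseteq> ball x r}) / real (card D) ^ k"
        by (intro divide_right_mono) auto
      also have "\<dots> \<le> measure M (ball x r)"
        by (intro count_le_bernoulli_measure[OF M]) auto
      finally show ?thesis .
    qed
    have mp: "0 < real (mass (lev k) w) / real (card D) ^ k"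
      using mass_pos[OF w(1)] card_D_pos by simp
    show ?thesis
    proof (cases k)
      \<comment> \<open>At level 0 minimality gives no upper bound on \<open>r\<close>, but the ball
        already has measure 1.\<close>
      case 0
      have "1 \<le> measure M (ball x r)"
        using lower w(1) by (simp add: 0 mass_def)
      hence "measure M (ball x (2 * r)) / measure M (ball x r) \<le> 1 / 1"
        by (intro frac_le prob_le_1) auto
      thus ?thesis by (simp add: C_def)
    next
      case (Suc k')
      hence "\<not> c0 / real m ^ k' < r" unfolding k_def using not_less_Least[of k'] by (metis lessI)
      hence r2: "2 * r \<le> (2 * real m * c0) / real m ^ k" using m_pos by (simp add: Suc field_simps)
      have "{u \<in> words D k. word_map n m u ` K \<inter> ball x (2 * r) \<noteq> {}} \<subseteq> {u \<in> words D k. near n m B u w}"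
      proof
        fix u assume "u \<in> {u \<in> words D k. word_map n m u ` K \<inter> ball x (2 * r) \<noteq> {}}"
        then obtain y where u: "u \<in> words D k" "y \<in> word_map n m u ` K" "y \<in> ball x (2 * r)" by blast
        have "dist y x \<le> (2 * real m * c0) / real m ^ k"
          using u(3) r2 by (simp add: dist_commute)
        thus "u \<in> {u \<in> words D k. near n m B u w}"
          using u(1) dist_imp_near[OF u(1) w(1) u(2) w(2) _ B] by blast
      qed
      hence "card {u \<in> words D k. word_map n m u ` K \<inter> ball x (2 * r) \<noteq> {}} \<le>
          card {u \<in> words D k. near n m B u w}"
        using finite_words[OF finite_D] by (intro card_mono) auto
      also have "\<dots> \<le> (2 * B + 1) ^ 2 * (c * mass (lev k) w)"
        by (rule card_near_words[OF w(1)]) (rule c[OF w(1)])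
      finally have count: "card {u \<in> words D k. word_map n m u ` K \<inter> ball x (2 * r) \<noteq> {}} \<le>
          (2 * B + 1) ^ 2 * (c * mass (lev k) w)" .
      have "measure M (ball x (2 * r)) \<le>
          real (card {u \<in> words D k. word_map n m u ` K \<inter> ball x (2 * r) \<noteq> {}}) / real (card D) ^ k"
        by (intro bernoulli_measure_le_count[OF M]) auto
      also have "\<dots> \<le> real ((2 * B + 1) ^ 2 * (c * mass (lev k) w)) / real (card D) ^ k"
        by (rule divide_right_mono[OF of_nat_mono[OF count]]) simp
      also have "\<dots> = real ((2 * B + 1) ^ 2 * c) * (real (mass (lev k) w) / real (card D) ^ k)"
        by simp
      also have "\<dots> \<le> C * measure M (ball x r)"
        using lower mp by (intro mult_mono) (auto simp: C_def)
      finally have "measure M (ball x (2 * r)) \<le> C * measure M (ball x r)" .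
      moreover have "0 < measure M (ball x r)" using mp lower by linarith
      ultimately show ?thesis by (simp only: pos_divide_le_eq)
    qed
  qed
  thus ?thesis unfolding doubling_measure_def by (intro bdd_aboveI[of _ C]) auto
qed

text \<open>If a run of positive length separates two near cells, both end rows are occupied and so
  are two adjacent rows. When the criterion fails, the end fibers must then be equal and the powers
  in \<open>near_mass\<close> cancel, so near masses are comparable.\<close>

lemma carry_of_non_doubling:
  assumes "non_doubling_type n m D"
  shows "carry_digit_set n m D"
proof (rule ccontr)
  assume not: "\<not> carry_digit_set n m D"
  have "doubling_measure (uniform_bernoulli n m D)"
  proof (rule doubling_of_mass_comparable[OF uniform_bernoulli])
    fix B
    have B: "B < m ^ B" using m_ge by (meson less_exp order_less_le_trans power_mono zero_le)
    have "mass (lev k) u \<le> n ^ Suc B * mass (lev k) w"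
      if wu: "w \<in> words D k" "u \<in> words D k" "near n m B u w" for k w u
    proof -
      obtain b b' e s s' r r' where b: "(b, b') \<in> {(0, m - 1), (m - 1, 0)}"
        and drop: "drop (lev k) (map snd u) = s @ replicate e b @ s'"
          "drop (lev k) (map snd w) = r @ replicate e b' @ r'"
        and adj: "0 < e \<longrightarrow> (\<exists>j. Suc j < m \<and> 0 < fiber D j \<and> 0 < fiber D (Suc j))"
        and le: "mass (lev k) u * fiber D b' ^ e \<le> n ^ Suc B * mass (lev k) w * fiber D b ^ e"
        using near_mass[OF wu(2,1,3) B, of "lev k"] by blast
      show ?thesis
      proof (cases "e = 0")
        case False
        have "b \<in> set (drop (lev k) (map snd u))" "b' \<in> set (drop (lev k) (map snd w))"
          unfolding drop using False by auto
        hence "b \<in> set (map snd u)" "b' \<in> set (map snd w)" by (meson in_set_dropD)+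
        hence pos: "0 < fiber D b" "0 < fiber D b'"
          using words_row_fiber[OF snd_word[OF wu(2)]] words_row_fiber[OF snd_word[OF wu(1)]] by blast+
        have "fiber D 0 = fiber D (m - 1)"
        proof (rule ccontr)
          assume "fiber D 0 \<noteq> fiber D (m - 1)"
          hence "carry_digit_set n m D"
            using pos b adj False by unfold_locales auto
          thus False using not by contradiction
        qed
        hence "fiber D b' = fiber D b" using b by auto
        thus ?thesis using le pos by simp
      qed (use le in simp)
    qed
    thus "\<exists>c. \<forall>k. \<forall>w\<in>words D k. \<forall>u\<in>words D k. near n m B u w \<longrightarrow>
      mass (lev k) u \<le> c * mass (lev k) w" by blast
  qed
  thus False using assms by (simp add: non_doubling_type_def)
qed

end

theorem theorem1p4:
  fixes n m :: nat and D D' :: "(nat \<times> nat) set"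
  assumes "2 \<le> m" and "m < n"
    and "D \<subseteq> {0..<n} \<times> {0..<m}" and "D \<noteq> {}"
    and "D' \<subseteq> {0..<n} \<times> {0..<m}" and "D' \<noteq> {}"
    and "non_doubling_type n m D" and "non_doubling_type n m D'"
    and "lipschitz_equivalent (carpet n m D) (carpet n m D')"
  shows "(\<exists>p. p permutes {0..<m} \<and> (\<forall>j<m. fiber D j = fiber D' (p j))) \<and>
    (fiber D 0 > fiber D (m - 1) \<and> fiber D' 0 > fiber D' (m - 1) \<longrightarrow>
       fiber D 0 = fiber D' 0 \<and> fiber D (m - 1) = fiber D' (m - 1))"
proof -
  interpret E: digit_set n m D using assms by unfold_locales
  interpret F: digit_set n m D' using assms by unfold_locales
  interpret E: carry_digit_set n m D by (rule E.carry_of_non_doubling[OF assms(7)])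
  interpret F: carry_digit_set n m D' by (rule F.carry_of_non_doubling[OF assms(8)])
  obtain rel \<beta> where "coarse_equiv n m D D' rel \<beta>"
    using coarse_equiv_of_lipschitz[OF E.digit_set_axioms F.digit_set_axioms assms(9)] by blast
  hence "carry_equiv n m D D' rel \<beta>"
    by (intro carry_equiv.intro E.carry_digit_set_axioms F.carry_digit_set_axioms)
  then interpret carry_equiv n m D D' rel \<beta> .
  \<comment> \<open>\<open>power_sum_eq\<close> ranges over occupied rows only. For a positive
    exponent the empty rows add 0; for exponent 0 both sums over all rows equal
    \<open>m\<close>.\<close>
  have sums: "(\<Sum>j\<in>{0..<m}. fiber D j ^ q) = (\<Sum>j\<in>{0..<m}. fiber D' j ^ q)" for q
  proof (cases q)
    case (Suc q')
    have "(\<Sum>j\<in>{0..<m}. fiber D j ^ q) = (\<Sum>j\<in>E.rows. fiber D j ^ q)"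
      using E.row_less E.fiber_pos unfolding Suc by (intro sum.mono_neutral_right) force+
    also have "\<dots> = (\<Sum>j\<in>F.rows. fiber D' j ^ q)" by (rule power_sum_eq)
    also have "\<dots> = (\<Sum>j\<in>{0..<m}. fiber D' j ^ q)"
      using F.row_less F.fiber_pos unfolding Suc by (intro sum.mono_neutral_left) force+
    finally show ?thesis .
  qed simp
  have "\<exists>p. p permutes {0..<m} \<and> (\<forall>j\<in>{0..<m}. fiber D j = fiber D' (p j))"
    by (rule power_sums_imp_permutes) (simp_all add: sums)
  moreover have "fiber D 0 = fiber D' 0 \<and> fiber D (m - 1) = fiber D' (m - 1)"
    if "fiber D 0 > fiber D (m - 1)" "fiber D' 0 > fiber D' (m - 1)"
    using hi_eq lo_eq that by (simp add: E.hi_def E.lo_def F.hi_def F.lo_def)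
  ultimately show ?thesis by auto
qed

end
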